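(* Let $N\ge 1$, $\gamma>0$, and let $u\in H^1_{loc}(\mathbb{R}^N_+)$ be a weak solution of problem $(\mathcal P_\gamma)$. Then $u$ is locally bounded up to the boundary, i.e. for every $R>0$, $u\in L^\infty(B_R(0)\cap\mathbb{R}^N_+)$.
   Context: $\mathbb{R}^N_+=\{x=(x_1,\dots,x_N)\in\mathbb{R}^N: x_N>0\}$. Problem $(\mathcal P_\gamma)$ is: $-\Delta u=u^{-\gamma}$ in $\mathbb{R}^N_+$, $u>0$ in $\mathbb{R}^N_+$, $u=0$ on $\partial\mathbb{R}^N_+$. A weak solution is a function $u\in H^1_{loc}(\mathbb{R}^N_+)$ with $u>0$ in $\mathbb{R}^N_+$ (and $u^{-\gamma}\in L^1_{loc}(\mathbb{R}^N_+)$) such that $\int_{\mathbb{R}^N_+}\nabla u\cdot\nabla\varphi\,dx=\int_{\mathbb{R}^N_+}u^{-\gamma}\varphi\,dx$ for all $\varphi\in C^1_c(\mathbb{R}^N_+)$, and which satisfies the zero Dirichlet condition in the weak sense: for every $\varepsilon>0$ and every $\varphi\in C^1_c(\mathbb{R}^N)$, $(u-\varepsilon)^+\varphi\,\chi_{\mathbb{R}^N_+}\in H^1_0(\mathbb{R}^N_+)$. *)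

theory Defs
  imports "HOL-Analysis.Analysis"
begin

text \<open>Ambient space: an arbitrary Euclidean space 'a (dimension N = DIM('a) >= 1),
  with a distinguished basis vector e playing the role of the N-th coordinate direction.\<close>

definition half_space :: "'a::euclidean_space \<Rightarrow> 'a set" where
  "half_space e = {x. x \<bullet> e > 0}"

definition C1c_test :: "'a::euclidean_space set \<Rightarrow> ('a \<Rightarrow> real) \<Rightarrow> ('a \<Rightarrow> 'a) \<Rightarrow> bool" where
  "C1c_test \<Omega> \<phi> g \<longleftrightarrow>
     (\<forall>x. (\<phi> has_derivative (\<lambda>h. g x \<bullet> h)) (at x)) \<and> continuous_on UNIV g \<and>
     compact (closure {x. \<phi> x \<noteq> 0}) \<and> closure {x. \<phi> x \<noteq> 0} \<subseteq> \<Omega>"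

definition C1c :: "('a::euclidean_space \<Rightarrow> real) \<Rightarrow> bool" where
  "C1c \<phi> \<longleftrightarrow> (\<exists>g. C1c_test UNIV \<phi> g)"

definition L1_loc :: "'a::euclidean_space set \<Rightarrow> ('a \<Rightarrow> real) \<Rightarrow> bool" where
  "L1_loc \<Omega> f \<longleftrightarrow> set_borel_measurable lborel \<Omega> f \<and>
     (\<forall>K. compact K \<and> K \<subseteq> \<Omega> \<longrightarrow> set_integrable lborel K f)"

definition L2_loc :: "'a::euclidean_space set \<Rightarrow> ('a \<Rightarrow> 'b::euclidean_space) \<Rightarrow> bool" where
  "L2_loc \<Omega> f \<longleftrightarrow> set_borel_measurable lborel \<Omega> f \<and>
     (\<forall>K. compact K \<and> K \<subseteq> \<Omega> \<longrightarrow> set_integrable lborel K (\<lambda>x. (norm (f x))\<^sup>2))"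

definition L2 :: "'a::euclidean_space set \<Rightarrow> ('a \<Rightarrow> 'b::euclidean_space) \<Rightarrow> bool" where
  "L2 \<Omega> f \<longleftrightarrow> set_borel_measurable lborel \<Omega> f \<and>
     set_integrable lborel \<Omega> (\<lambda>x. (norm (f x))\<^sup>2)"

definition weak_gradient :: "'a::euclidean_space set \<Rightarrow> ('a \<Rightarrow> real) \<Rightarrow> ('a \<Rightarrow> 'a) \<Rightarrow> bool" where
  "weak_gradient \<Omega> u G \<longleftrightarrow>
     (\<forall>\<phi> g. C1c_test \<Omega> \<phi> g \<longrightarrow>
        (LINT x:\<Omega>|lborel. u x *\<^sub>R g x) = - (LINT x:\<Omega>|lborel. \<phi> x *\<^sub>R G x))"

definition H1_loc_grad :: "'a::euclidean_space set \<Rightarrow> ('a \<Rightarrow> real) \<Rightarrow> ('a \<Rightarrow> 'a) \<Rightarrow> bool" where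
  "H1_loc_grad \<Omega> u G \<longleftrightarrow> L2_loc \<Omega> u \<and> L2_loc \<Omega> G \<and> weak_gradient \<Omega> u G"

definition H1_loc :: "'a::euclidean_space set \<Rightarrow> ('a \<Rightarrow> real) \<Rightarrow> bool" where
  "H1_loc \<Omega> u \<longleftrightarrow> (\<exists>G. H1_loc_grad \<Omega> u G)"

text \<open>H^1_0(Omega): closure of C^1_c(Omega) in the H^1(Omega) norm
  (equivalently of C^\<infinity>_c(Omega)).\<close>
definition H1_0 :: "'a::euclidean_space set \<Rightarrow> ('a \<Rightarrow> real) \<Rightarrow> bool" where
  "H1_0 \<Omega> w \<longleftrightarrow> (\<exists>G. L2 \<Omega> w \<and> L2 \<Omega> G \<and> weak_gradient \<Omega> w G \<and>
     (\<exists>\<phi> g. (\<forall>k. C1c_test \<Omega> (\<phi> k) (g k)) \<and>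
        (\<lambda>k. (LINT x:\<Omega>|lborel. (w x - \<phi> k x)\<^sup>2 + (norm (G x - g k x))\<^sup>2)) \<longlonglongrightarrow> 0))"

definition weak_solution :: "'a::euclidean_space \<Rightarrow> real \<Rightarrow> ('a \<Rightarrow> real) \<Rightarrow> bool" where
  "weak_solution e \<gamma> u \<longleftrightarrow>
     (\<forall>x\<in>half_space e. u x > 0) \<and>
     L1_loc (half_space e) (\<lambda>x. u x powr (-\<gamma>)) \<and>
     (\<exists>G. H1_loc_grad (half_space e) u G \<and>
        (\<forall>\<phi> g. C1c_test (half_space e) \<phi> g \<longrightarrow>
           (LINT x:half_space e|lborel. G x \<bullet> g x) =
           (LINT x:half_space e|lborel. u x powr (-\<gamma>) * \<phi> x))) \<and>
     (\<forall>\<epsilon>>0. \<forall>\<phi>. C1c \<phi> \<longrightarrow>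
        H1_0 (half_space e)
          (\<lambda>x. max (u x - \<epsilon>) 0 * \<phi> x * indicator (half_space e) x))"

end

theory Submission
  imports Defs
begin

text \<open>
  Let \<open>w = (u - 1)\<^sup>+\<close>, extended by zero outside the half space. The Dirichlet condition makes \<open>w\<close>, after
  multiplication by a cutoff, an \<open>H\<^sup>1\<close> limit of test functions \<open>\<phi> k\<close>. Testing the equation with
  \<open>\<beta> (\<phi> j) \<beta> (\<phi> k) \<psi>\<close>, where \<open>\<beta> t = t\<^sup>2 / (1 + t\<^sup>2)\<close>, and letting first \<open>j\<close> and then \<open>k\<close> tend to infinity
  shows that \<open>V = \<Lambda> w\<close>, with \<open>\<Lambda>' = \<beta>\<^sup>2\<close>, satisfies \<open>\<Delta> V \<ge> -1\<close> in the sense of distributions on the whole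
  space, because \<open>u powr (-\<gamma>) \<le> 1\<close> where \<open>w > 0\<close>. The factor \<open>\<beta> (\<phi> k)\<close> keeps the support away from the
  boundary and \<open>\<beta> (\<phi> j)\<close> restricts to \<open>{u > 1}\<close>, the only place where the gradient of \<open>u\<close> is controlled up
  to the boundary.

  Such a \<open>V\<close> is locally bounded above: for a suitable radial kernel \<open>k\<^sub>r\<close> of scale \<open>r\<close>, the derivative
  \<open>\<partial>k\<^sub>r/\<partial>r\<close> is the Laplacian of a nonnegative compactly supported function of integral at most a
  multiple of \<open>r\<close>, so the averages of \<open>V\<close> at scale \<open>\<delta>\<close> are bounded by those at scale \<open>1\<close> plus a constant.
  Finally \<open>\<Lambda> t \<ge> t - 3\<close>.
\<close>

section \<open>Compactly supported test functions\<close>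

text \<open>The gradient of \<open>u\<close> is square integrable only on compact subsets of the
  half space and \<open>u powr (-\<gamma>)\<close> may blow up at the boundary, so nothing that
  reaches the boundary can be inserted into the equation directly. This forces two separate limits.
  With k fixed, the support of \<open>\<beta> (\<phi> k)\<close> is compact in the half space and
  local bounds suffice; after the limit in j, the factor \<open>\<beta> (W x)\<close> has replaced
  the gradient of \<open>u\<close> by that of the truncation, which is globally square integrable,
  and the limit in k uses only global bounds. Differentiating the factors \<open>\<beta>\<close>
  produces terms with a favourable sign in the limit; dropping them leaves an inequality in the
  direction needed. Since it holds across the boundary, boundedness up to the boundary becomes an
  interior statement.

  The kernel needs no potential theory: a mass-preserving dilation k_r(z) = r^(-N) k(z/r) satisfies
  dk_r/dr = - div(z k_r) / r, and for radial k the field z k_r is a gradient, so the derivative in r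
  is a Laplacian. A polynomial profile makes everything explicit.\<close>

definition C1_grad :: "('a::euclidean_space \<Rightarrow> real) \<Rightarrow> ('a \<Rightarrow> 'a) \<Rightarrow> bool" where
  "C1_grad f g \<longleftrightarrow> (\<forall>x. (f has_derivative (\<lambda>h. g x \<bullet> h)) (at x)) \<and> continuous_on UNIV g"

lemma C1_gradD:
  assumes "C1_grad f g"
  shows "(f has_derivative (\<lambda>h. g x \<bullet> h)) (at x)" "continuous_on UNIV g" "continuous_on UNIV f"
    "f \<in> borel_measurable borel" "g \<in> borel_measurable borel"
proof -
  show 1: "(f has_derivative (\<lambda>h. g x \<bullet> h)) (at x)" and 2: "continuous_on UNIV g" for x
    using assms by (auto simp: C1_grad_def)
  have "isCont f x" for x using 1 has_derivative_continuous by blast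
  then show 3: "continuous_on UNIV f" by (simp add: continuous_at_imp_continuous_on)
  show "f \<in> borel_measurable borel" "g \<in> borel_measurable borel"
    using 2 3 by (auto intro: borel_measurable_continuous_onI)
qed

lemma C1_grad_mult:
  assumes "C1_grad f f'" "C1_grad g g'"
  shows "C1_grad (\<lambda>x. f x * g x) (\<lambda>x. f x *\<^sub>R g' x + g x *\<^sub>R f' x)"
  unfolding C1_grad_def
proof (intro conjI allI)
  fix x
  show "((\<lambda>x. f x * g x) has_derivative (\<lambda>h. (f x *\<^sub>R g' x + g x *\<^sub>R f' x) \<bullet> h)) (at x)"
    by (rule has_derivative_eq_rhs[OF has_derivative_mult[OF C1_gradD(1)[OF assms(1)] C1_gradD(1)[OF assms(2)]]])
       (auto simp: inner_add_left algebra_simps)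
  show "continuous_on UNIV (\<lambda>x. f x *\<^sub>R g' x + g x *\<^sub>R f' x)"
    by (intro continuous_intros C1_gradD[OF assms(1)] C1_gradD[OF assms(2)])
qed

lemma C1_grad_compose:
  assumes "C1_grad f f'" and \<beta>: "\<And>t. (\<beta> has_real_derivative \<beta>' t) (at t)" "continuous_on UNIV \<beta>'"
  shows "C1_grad (\<lambda>x. \<beta> (f x)) (\<lambda>x. \<beta>' (f x) *\<^sub>R f' x)"
  unfolding C1_grad_def
proof (intro conjI allI)
  fix x
  have "((\<lambda>x. \<beta> (f x)) has_derivative (\<lambda>h. \<beta>' (f x) * (f' x \<bullet> h))) (at x)"
    using has_derivative_compose[OF C1_gradD(1)[OF assms(1)], of \<beta> "\<lambda>h. \<beta>' (f x) * h"] \<beta>(1)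
    by (auto simp: has_field_derivative_def)
  then show "((\<lambda>x. \<beta> (f x)) has_derivative (\<lambda>h. (\<beta>' (f x) *\<^sub>R f' x) \<bullet> h)) (at x)" by simp
  show "continuous_on UNIV (\<lambda>x. \<beta>' (f x) *\<^sub>R f' x)"
    by (intro continuous_intros C1_gradD[OF assms(1)] continuous_on_compose2[OF \<beta>(2)]) auto
qed

lemma C1_grad_cmult:
  assumes "C1_grad f f'"
  shows "C1_grad (\<lambda>x. c * f x) (\<lambda>x. c *\<^sub>R f' x)"
  by (rule C1_grad_compose[OF assms]) (auto intro!: derivative_eq_intros)

lemma C1_grad_sum:
  assumes "\<And>i. i \<in> I \<Longrightarrow> C1_grad (f i) (f' i)"
  shows "C1_grad (\<lambda>x. \<Sum>i\<in>I. f i x) (\<lambda>x. \<Sum>i\<in>I. f' i x)"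
  unfolding C1_grad_def
proof (intro conjI allI)
  fix x
  show "((\<lambda>x. \<Sum>i\<in>I. f i x) has_derivative (\<lambda>h. (\<Sum>i\<in>I. f' i x) \<bullet> h)) (at x)"
    unfolding inner_sum_left
    by (rule has_derivative_sum) (use C1_gradD(1)[OF assms] in auto)
  show "continuous_on UNIV (\<lambda>x. \<Sum>i\<in>I. f' i x)"
    by (intro continuous_intros C1_gradD(2)[OF assms])
qed

lemma C1_grad_inner_const: "C1_grad (\<lambda>x. (x - y) \<bullet> b) (\<lambda>x. b)"
  unfolding C1_grad_def by (auto intro!: derivative_eq_intros simp: inner_commute)

lemma C1_grad_norm_diff: "C1_grad (\<lambda>x. c - (norm (x - y))\<^sup>2) (\<lambda>x. (-2) *\<^sub>R (x - y))"
  unfolding C1_grad_def power2_norm_eq_inner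
  by (auto intro!: derivative_eq_intros continuous_intros simp: inner_commute inner_diff_left inner_diff_right)

text \<open>The square is the lowest natural power of the positive part that is C1, hence the
  exponent \<open>n+2\<close>; at zero the difference quotient is at most
  \<open>\<bar>s\<bar> ^ (n+1)\<close>. This form avoids subtraction on the naturals and explains
  the exponents \<open>0+2\<close> and \<open>1+2\<close> in later uses.\<close>

lemma DERIV_pos_part_power:
  "((\<lambda>t::real. max 0 t ^ (n+2)) has_real_derivative real (n+2) * max 0 t ^ (n+1)) (at t)"
proof -
  consider "t > 0" | "t < 0" | "t = 0" by linarith
  then show ?thesis
  proof cases
    case 1
    have "((\<lambda>t::real. t ^ (n+2)) has_real_derivative real (n+2) * t ^ (n+1)) (at t)"
      by (rule DERIV_cong[OF DERIV_pow]) simp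
    moreover have "eventually (\<lambda>s. max 0 s ^ (n+2) = s ^ (n+2)) (nhds t)"
      using eventually_nhds_in_open[of "{0<..}" t] 1 by (auto elim!: eventually_mono simp: max_def)
    ultimately show ?thesis using 1 by (subst DERIV_cong_ev[OF refl _ refl]) (auto simp: max_def)
  next
    case 2
    have "((\<lambda>t::real. 0::real) has_real_derivative 0) (at t)" by simp
    moreover have "eventually (\<lambda>s. max 0 s ^ (n+2) = (0::real)) (nhds t)"
      using eventually_nhds_in_open[of "{..<0}" t] 2 by (auto elim!: eventually_mono simp: max_def)
    ultimately show ?thesis using 2 DERIV_cong_ev[OF refl, of _ "\<lambda>_. 0" t 0 0] by (simp add: max_def)
  next
    case 3
    have "((\<lambda>s::real. max 0 s ^ (n+2) / s) \<longlongrightarrow> 0) (at 0)"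
    proof (rule Lim_null_comparison)
      show "eventually (\<lambda>s::real. norm (max 0 s ^ (n+2) / s) \<le> \<bar>s\<bar> ^ (n+1)) (at 0)"
      proof (rule always_eventually, rule allI)
        fix s :: real
        show "norm (max 0 s ^ (n+2) / s) \<le> \<bar>s\<bar> ^ (n+1)"
        proof (cases "s \<le> 0")
          case True
          then have "max 0 s ^ (n+2) = 0" by (simp add: max_absorb1)
          then show ?thesis by (metis abs_ge_zero div_0 norm_zero zero_le_power)
        qed (simp add: max_absorb2 field_simps)
      qed
      show "((\<lambda>s::real. \<bar>s\<bar> ^ (n+1)) \<longlongrightarrow> 0) (at 0)"
        by (auto intro!: tendsto_eq_intros)
    qed
    then show ?thesis using 3 by (simp add: has_field_derivative_iff)
  qed
qed

lemma C1_grad_pos_part_power: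
  assumes "C1_grad f f'"
  shows "C1_grad (\<lambda>x. max 0 (f x) ^ (n+2)) (\<lambda>x. (real (n+2) * max 0 (f x) ^ (n+1)) *\<^sub>R f' x)"
  by (rule C1_grad_compose[OF assms DERIV_pos_part_power]) (intro continuous_intros)

text \<open>\<open>C1c_test\<close> speaks of the support of \<open>\<phi>\<close> only; off that
  closed set \<open>\<phi>\<close> is locally zero, so the gradient vanishes as well. One compact
  \<open>K\<close> serving both functions handles products and compositions without computing
  closures.\<close>

lemma C1c_test_iff:
  "C1c_test \<Omega> \<phi> g \<longleftrightarrow> C1_grad \<phi> g \<and> (\<exists>K. compact K \<and> K \<subseteq> \<Omega> \<and> (\<forall>x. x \<notin> K \<longrightarrow> \<phi> x = 0 \<and> g x = 0))"
proof
  assume *: "C1c_test \<Omega> \<phi> g"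
  let ?K = "closure {x. \<phi> x \<noteq> 0}"
  have z: "\<phi> x = 0" if "x \<notin> ?K" for x
    using that by (metis (mono_tags, lifting) closure_subset mem_Collect_eq subsetD)
  have "g x = 0" if "x \<notin> ?K" for x
  proof -
    have "(\<phi> has_derivative (\<lambda>h. 0)) (at x)"
    proof (rule has_derivative_transform_within_open[of "\<lambda>_. 0" _ _ _ "- ?K"])
      show "x \<in> - ?K" using that by simp
      show "0 = \<phi> y" if "y \<in> - ?K" for y using z[OF ComplD[OF that]] by (rule sym)
    qed auto
    then have "(\<lambda>h. g x \<bullet> h) = (\<lambda>h. 0)"
      using * has_derivative_unique unfolding C1c_test_def by blast
    then have "g x \<bullet> g x = 0" by (rule fun_cong)
    then show ?thesis by simp
  qed
  with z show "C1_grad \<phi> g \<and> (\<exists>K. compact K \<and> K \<subseteq> \<Omega> \<and> (\<forall>x. x \<notin> K \<longrightarrow> \<phi> x = 0 \<and> g x = 0))"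
    using * unfolding C1c_test_def C1_grad_def by blast
next
  assume "C1_grad \<phi> g \<and> (\<exists>K. compact K \<and> K \<subseteq> \<Omega> \<and> (\<forall>x. x \<notin> K \<longrightarrow> \<phi> x = 0 \<and> g x = 0))"
  then obtain K where *: "C1_grad \<phi> g" "compact K" "K \<subseteq> \<Omega>" "\<And>x. x \<notin> K \<Longrightarrow> \<phi> x = 0" by blast
  have cl: "closure {x. \<phi> x \<noteq> 0} \<subseteq> K"
    using * by (intro closure_minimal) (auto simp: compact_imp_closed)
  moreover have "compact (closure {x. \<phi> x \<noteq> 0})"
    using cl * by (meson bounded_subset closed_closure compact_eq_bounded_closed)
  ultimately show "C1c_test \<Omega> \<phi> g" using * unfolding C1c_test_def C1_grad_def by blast
qed

lemma C1c_test_supportE: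
  assumes "C1c_test \<Omega> \<phi> g"
  obtains K where "compact K" "K \<subseteq> \<Omega>" "\<And>x. x \<notin> K \<Longrightarrow> \<phi> x = 0" "\<And>x. x \<notin> K \<Longrightarrow> g x = 0"
  using assms unfolding C1c_test_iff by blast

lemma C1c_test_C1_grad: "C1c_test \<Omega> \<phi> g \<Longrightarrow> C1_grad \<phi> g"
  by (simp add: C1c_test_iff)

lemma C1c_test_outside:
  assumes "C1c_test \<Omega> \<phi> g" "x \<notin> \<Omega>" shows "\<phi> x = 0" "g x = 0"
  using assms unfolding C1c_test_iff by blast+

lemma C1c_test_mono: "C1c_test \<Omega> \<phi> g \<Longrightarrow> \<Omega> \<subseteq> \<Omega>' \<Longrightarrow> C1c_test \<Omega>' \<phi> g"
  unfolding C1c_test_iff by blast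

lemma C1c_test_mult_C1:
  assumes "C1_grad f f'" "C1c_test \<Omega> \<phi> g"
  shows "C1c_test \<Omega> (\<lambda>x. f x * \<phi> x) (\<lambda>x. f x *\<^sub>R g x + \<phi> x *\<^sub>R f' x)"
proof -
  obtain K where K: "compact K" "K \<subseteq> \<Omega>" "\<And>x. x \<notin> K \<Longrightarrow> \<phi> x = 0 \<and> g x = 0"
    using assms(2) unfolding C1c_test_iff by blast
  show ?thesis unfolding C1c_test_iff
    by (intro conjI exI[of _ K] C1_grad_mult assms(1) C1c_test_C1_grad[OF assms(2)]) (use K in auto)
qed

lemma C1c_test_mult:
  assumes "C1c_test \<Omega>1 \<phi>1 g1" "C1c_test \<Omega>2 \<phi>2 g2"
  shows "C1c_test (\<Omega>1 \<inter> \<Omega>2) (\<lambda>x. \<phi>1 x * \<phi>2 x) (\<lambda>x. \<phi>1 x *\<^sub>R g2 x + \<phi>2 x *\<^sub>R g1 x)"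
proof -
  obtain K where K: "compact K" "K \<subseteq> \<Omega>1" "\<And>x. x \<notin> K \<Longrightarrow> \<phi>1 x = 0 \<and> g1 x = 0"
    using assms(1) unfolding C1c_test_iff by blast
  obtain L where L: "compact L" "L \<subseteq> \<Omega>2" "\<And>x. x \<notin> L \<Longrightarrow> \<phi>2 x = 0 \<and> g2 x = 0"
    using assms(2) unfolding C1c_test_iff by blast
  show ?thesis unfolding C1c_test_iff
    by (intro conjI exI[of _ "K \<inter> L"] C1_grad_mult C1c_test_C1_grad[OF assms(2)] C1c_test_C1_grad[OF assms(1)])
       (use K L in auto)
qed

lemma C1c_test_compose:
  assumes "C1c_test \<Omega> \<phi> g" "\<And>t. (\<beta> has_real_derivative \<beta>' t) (at t)" "continuous_on UNIV \<beta>'" "\<beta> 0 = 0"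
  shows "C1c_test \<Omega> (\<lambda>x. \<beta> (\<phi> x)) (\<lambda>x. \<beta>' (\<phi> x) *\<^sub>R g x)"
proof -
  obtain K where K: "compact K" "K \<subseteq> \<Omega>" "\<And>x. x \<notin> K \<Longrightarrow> \<phi> x = 0 \<and> g x = 0"
    using assms(1) unfolding C1c_test_iff by blast
  show ?thesis unfolding C1c_test_iff
    by (intro conjI exI[of _ K] C1_grad_compose C1c_test_C1_grad[OF assms(1)] assms) (use K assms in auto)
qed

section \<open>Bounds and integrals of compactly supported functions\<close>

lemma continuous_compact_support_bounded:
  fixes f :: "'a::euclidean_space \<Rightarrow> 'b::real_normed_vector"
  assumes "continuous_on UNIV f" "compact K" "\<And>x. x \<notin> K \<Longrightarrow> f x = 0"
  obtains C where "C > 0" "\<And>x. norm (f x) \<le> C * indicator K x"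
proof -
  have "compact (f ` K)" using assms by (meson compact_continuous_image continuous_on_subset subset_UNIV)
  then obtain C where C: "C > 0" "\<And>y. y \<in> f ` K \<Longrightarrow> norm y \<le> C"
    by (meson bounded_pos compact_imp_bounded)
  show ?thesis
    by (rule that[OF C(1)]) (use C assms(3) in \<open>auto simp: indicator_def\<close>)
qed

lemma integrable_indicator_compact:
  "compact K \<Longrightarrow> integrable lborel (\<lambda>x. C * indicator K x :: real)" for K :: "'a::euclidean_space set"
  using emeasure_compact_finite[of K] borel_compact[of K]
  by (intro integrable_mult_right integrable_real_indicator) simp_all

lemma integrable_continuous_compact_support:
  fixes f :: "'a::euclidean_space \<Rightarrow> 'b::euclidean_space"
  assumes "continuous_on UNIV f" "compact K" "\<And>x. x \<notin> K \<Longrightarrow> f x = 0"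
  shows "integrable lborel f"
proof -
  obtain C where C: "\<And>x. norm (f x) \<le> C * indicator K x"
    using continuous_compact_support_bounded[OF assms] by blast
  have [measurable]: "f \<in> borel_measurable borel" using assms by (intro borel_measurable_continuous_onI)
  show ?thesis
    by (rule Bochner_Integration.integrable_bound[OF integrable_indicator_compact[OF assms(2), of C]])
       (use C in \<open>auto intro: order_trans[OF _ abs_ge_self]\<close>)
qed

lemma C1c_test_lipschitz:
  fixes \<phi> :: "'a::euclidean_space \<Rightarrow> real"
  assumes "C1c_test \<Omega> \<phi> g"
  obtains L where "L > 0" "\<And>x y. \<bar>\<phi> x - \<phi> y\<bar> \<le> L * norm (x - y)"
proof -
  note C1 = C1c_test_C1_grad[OF assms]
  obtain K where K: "compact K" "\<And>x. x \<notin> K \<Longrightarrow> g x = 0"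
    using C1c_test_supportE[OF assms] by metis
  obtain C where C: "C > 0" "\<And>x. norm (g x) \<le> C * indicator K x"
    using continuous_compact_support_bounded[OF C1_gradD(2)[OF C1] K] by blast
  have C': "norm (g x) \<le> C" for x using C(1) C(2)[of x] by (cases "x \<in> K") auto
  have "norm (\<phi> x - \<phi> y) \<le> C * norm (x - y)" for x y
  proof (rule differentiable_bound[of UNIV _ "\<lambda>x h. g x \<bullet> h"])
    show "onorm (\<lambda>h. g x \<bullet> h) \<le> C" for x
      by (rule onorm_bound)
         (use C' C(1) in \<open>auto intro!: order_trans[OF Cauchy_Schwarz_ineq2] mult_right_mono\<close>)
  qed (use C1_gradD(1)[OF C1] in auto)
  then show ?thesis using that C(1) by simp
qed

text \<open>By translation invariance the integral of every difference quotient vanishes.\<close>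

lemma integral_gradient_C1c:
  fixes \<phi> :: "'a::euclidean_space \<Rightarrow> real"
  assumes "C1c_test \<Omega> \<phi> g"
  shows "integrable lborel g" "(\<integral>x. g x \<partial>lborel) = 0"
proof -
  note C1 = C1c_test_C1_grad[OF assms]
  obtain K where K: "compact K" "\<And>x. x \<notin> K \<Longrightarrow> \<phi> x = 0" "\<And>x. x \<notin> K \<Longrightarrow> g x = 0"
    using C1c_test_supportE[OF assms] by metis
  show ig: "integrable lborel g"
    by (rule integrable_continuous_compact_support[OF C1_gradD(2)[OF C1] K(1,3)])
  have i\<phi>: "integrable lborel \<phi>"
    by (rule integrable_continuous_compact_support[OF C1_gradD(3)[OF C1] K(1,2)])
  obtain C where C: "C > 0" and lip: "\<And>x y. \<bar>\<phi> x - \<phi> y\<bar> \<le> C * norm (x - y)"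
    using C1c_test_lipschitz[OF assms] by blast
  have [measurable]: "\<phi> \<in> borel_measurable borel" "g \<in> borel_measurable borel"
    using C1_gradD[OF C1] by auto
  obtain \<rho> where \<rho>: "\<And>x. x \<in> K \<Longrightarrow> norm x \<le> \<rho>" using compact_imp_bounded[OF K(1)] by (auto simp: bounded_iff)
  have zero: "(\<integral>x. g x \<bullet> b \<partial>lborel) = 0" if b: "b \<in> Basis" for b
  proof -
    \<comment> \<open>Steps of length at most 1 keep the shifted support inside the ball of radius
      \<open>\<rho> + 1\<close>, which carries the common majorant; the Lipschitz bound gives its
      height.\<close>
    define h where "h n = 1 / real (Suc n)" for n
    have h: "h n > 0" "h n \<le> 1" for n by (auto simp: h_def)
    define q where "q n x = (\<phi> (h n *\<^sub>R b + x) - \<phi> x) / h n" for n x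
    have q0: "(\<integral>x. q n x \<partial>lborel) = 0" for n
    proof -
      have i2: "integrable lborel (\<lambda>x. \<phi> (h n *\<^sub>R b + x))"
        using i\<phi> by (subst (asm) lborel_distr_plus[symmetric, of "h n *\<^sub>R b"]) (simp add: integrable_distr_eq)
      have "(\<integral>x. \<phi> (h n *\<^sub>R b + x) \<partial>lborel) = (\<integral>x. \<phi> x \<partial>lborel)"
        by (subst (2) lborel_distr_plus[symmetric, of "h n *\<^sub>R b"]) (simp add: integral_distr)
      then show ?thesis unfolding q_def using i2 i\<phi> by simp
    qed
    have "(\<lambda>n. \<integral>x. q n x \<partial>lborel) \<longlonglongrightarrow> (\<integral>x. g x \<bullet> b \<partial>lborel)"
    proof (rule integral_dominated_convergence[where w="\<lambda>x. C * indicator (cball 0 (\<rho> + 1)) x"])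
      show "integrable lborel (\<lambda>x::'a. C * indicator (cball 0 (\<rho> + 1)) x)"
        by (rule integrable_indicator_compact) simp
      show "AE x in lborel. norm (q n x) \<le> C * indicator (cball 0 (\<rho> + 1)) x" for n
      proof (rule AE_I2)
        fix x
        have nb: "norm (h n *\<^sub>R b) = h n" using h[of n] b by simp
        show "norm (q n x) \<le> C * indicator (cball 0 (\<rho> + 1)) x"
        proof (cases "norm x \<le> \<rho> + 1")
          case True
          have "\<bar>\<phi> (h n *\<^sub>R b + x) - \<phi> x\<bar> \<le> C * h n" using lip[of "h n *\<^sub>R b + x" x] nb by simp
          then show ?thesis using True h[of n] by (simp add: q_def divide_le_eq abs_divide)
        next
          case False
          then have "x \<notin> K" using \<rho>[of x] by auto
          moreover have "h n *\<^sub>R b + x \<notin> K"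
          proof
            assume "h n *\<^sub>R b + x \<in> K"
            then have "norm (h n *\<^sub>R b + x) \<le> \<rho>" by (rule \<rho>)
            moreover have "norm x \<le> norm (h n *\<^sub>R b + x) + norm (h n *\<^sub>R b)"
              by (metis add_diff_cancel_left' norm_triangle_sub norm_minus_commute add.commute)
            ultimately show False using False nb h[of n] by linarith
          qed
          ultimately show ?thesis using K(2) False by (simp add: q_def)
        qed
      qed
      show "AE x in lborel. (\<lambda>n. q n x) \<longlonglongrightarrow> g x \<bullet> b"
      proof (rule AE_I2)
        fix x
        have "((\<lambda>t. \<phi> (t *\<^sub>R b + x)) has_derivative (\<lambda>t. g x \<bullet> (t *\<^sub>R b))) (at 0)"
        proof (rule has_derivative_compose[of "\<lambda>t. t *\<^sub>R b + x" "\<lambda>t. t *\<^sub>R b"])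
          show "((\<lambda>t. t *\<^sub>R b + x) has_derivative (\<lambda>t. t *\<^sub>R b)) (at 0)"
            by (auto intro!: derivative_eq_intros)
          show "(\<phi> has_derivative (\<bullet>) (g x)) (at (0 *\<^sub>R b + x))"
            using C1_gradD(1)[OF C1, of x] by simp
        qed
        then have "((\<lambda>t. \<phi> (t *\<^sub>R b + x)) has_real_derivative (g x \<bullet> b)) (at 0)"
          unfolding has_field_derivative_def by (rule has_derivative_eq_rhs) (simp add: fun_eq_iff)
        then have l: "((\<lambda>t. (\<phi> (t *\<^sub>R b + x) - \<phi> x) / t) \<longlongrightarrow> g x \<bullet> b) (at 0)"
          by (simp add: has_field_derivative_iff)
        have "h \<longlonglongrightarrow> 0"
          using LIMSEQ_Suc[OF lim_1_over_n[where 'a=real]] by (simp add: h_def[abs_def] inverse_eq_divide)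
        then have "filterlim h (at 0) sequentially"
          unfolding filterlim_at using h(1) by (simp add: less_imp_neq[symmetric])
        from filterlim_compose[OF l this] show "(\<lambda>n. q n x) \<longlonglongrightarrow> g x \<bullet> b" by (simp add: q_def)
      qed
    qed (auto simp: q_def)
    then show ?thesis by (simp add: q0 LIMSEQ_const_iff)
  qed
  show "(\<integral>x. g x \<partial>lborel) = 0"
    by (rule euclidean_eqI) (use zero integral_inner_left[OF ig] in force)
qed

text \<open>A finite cover of \<open>K\<close> by balls gives a C1 function \<open>s\<close> that is
  positive on \<open>K\<close>, hence at least some \<open>m > 0\<close> there by compactness. A C1
  profile that is 0 at 0 and 1 beyond \<open>m\<close> then flattens it to 1 on \<open>K\<close>,
  without any mollification.\<close>

lemma C1c_cutoff:
  fixes K :: "'a::euclidean_space set"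
  assumes "compact K" "open U" "K \<subseteq> U"
  obtains \<phi> g where "C1c_test U \<phi> g" "\<And>x. 0 \<le> \<phi> x" "\<And>x. \<phi> x \<le> 1" "\<And>x. x \<in> K \<Longrightarrow> \<phi> x = 1"
proof (cases "K = {}")
  case True
  have "C1c_test U (\<lambda>x. 0) (\<lambda>x. 0)" unfolding C1c_test_iff C1_grad_def
    using has_derivative_const[of "0::real"] by (auto simp: inner_zero_left[abs_def] intro!: exI[of _ "{}"])
  then show ?thesis by (rule that) (use True in auto)
next
  case False
  obtain \<epsilon> where \<epsilon>: "\<epsilon> > 0" "(\<Union>x\<in>K. cball x \<epsilon>) \<subseteq> U"
    using compact_subset_open_imp_cball_epsilon_subset[OF assms] by blast
  obtain C where C: "C \<subseteq> K" "finite C" "K \<subseteq> (\<Union>c\<in>C. ball c \<epsilon>)"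
    using compactE_image[OF assms(1), of K "\<lambda>c. ball c \<epsilon>"] \<epsilon>(1) by (metis UN_I centre_in_ball open_ball subsetI)
  define p where "p c x = max 0 (\<epsilon>\<^sup>2 - (norm (x - c))\<^sup>2) ^ (0+2)" for c x :: 'a
  define p' where "p' c x = (real (0+2) * max 0 (\<epsilon>\<^sup>2 - (norm (x - c))\<^sup>2) ^ (0+1)) *\<^sub>R ((-2) *\<^sub>R (x - c))" for c x :: 'a
  have p: "C1_grad (p c) (p' c)" for c
    unfolding p_def[abs_def] p'_def[abs_def] by (rule C1_grad_pos_part_power[OF C1_grad_norm_diff])
  define s where "s x = (\<Sum>c\<in>C. p c x)" for x
  define s' where "s' x = (\<Sum>c\<in>C. p' c x)" for x
  have s: "C1_grad s s'" unfolding s_def[abs_def] s'_def[abs_def] by (rule C1_grad_sum[OF p])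
  have p0: "p c x = 0" "p' c x = 0" if "x \<notin> cball c \<epsilon>" for c x
  proof -
    have "\<epsilon> < norm (x - c)" using that by (simp add: dist_norm norm_minus_commute)
    then have "\<epsilon>\<^sup>2 \<le> (norm (x - c))\<^sup>2" using \<epsilon>(1) by (intro power_mono) auto
    then show "p c x = 0" "p' c x = 0" by (auto simp: p_def p'_def max_def)
  qed
  have s_nonneg: "s x \<ge> 0" for x unfolding s_def p_def by (intro sum_nonneg) auto
  have s_pos: "s x > 0" if xK: "x \<in> K" for x
  proof -
    obtain c where c: "c \<in> C" "dist c x < \<epsilon>" using C(3) xK by auto
    have "(norm (x - c))\<^sup>2 < \<epsilon>\<^sup>2" using c(2) by (intro power_strict_mono) (auto simp: dist_norm norm_minus_commute)
    then have "p c x > 0" by (simp add: p_def)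
    moreover have "p c x \<le> s x"
      unfolding s_def using c(1) C(2) by (intro member_le_sum) (auto simp: p_def)
    ultimately show ?thesis by linarith
  qed
  obtain x0 where x0: "x0 \<in> K" "\<And>x. x \<in> K \<Longrightarrow> s x0 \<le> s x"
    using continuous_attains_inf[OF assms(1) False, of s] C1_gradD(3)[OF s] continuous_on_subset by blast
  define m where "m = s x0"
  have m: "m > 0" unfolding m_def using s_pos x0 by auto
  \<comment> \<open>The slope of this profile vanishes at \<open>m\<close>, so it joins the constant
    1 in a C1 way; on nonnegative arguments its values lie between 0 and 1.\<close>
  define q where "q t = 1 - max 0 (1 - t / m) ^ (0+2)" for t
  define q' where "q' t = (real (0+2) * max 0 (1 - t / m) ^ (0+1)) / m" for t
  have q: "(q has_real_derivative q' t) (at t)" for t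
  proof -
    have "((\<lambda>t. max 0 (1 - t / m) ^ (0+2)) has_real_derivative (real (0+2) * max 0 (1 - t / m) ^ (0+1)) * (-1 / m)) (at t)"
      by (rule DERIV_chain2[OF DERIV_pos_part_power]) (use m in \<open>auto intro!: derivative_eq_intros\<close>)
    from DERIV_diff[OF DERIV_const this, of 1] show ?thesis by (simp add: q_def[abs_def] q'_def)
  qed
  have q_C: "continuous_on UNIV q'" unfolding q'_def using m by (intro continuous_intros) auto
  have "C1_grad (\<lambda>x. q (s x)) (\<lambda>x. q' (s x) *\<^sub>R s' x)" by (rule C1_grad_compose[OF s q q_C])
  moreover have "compact (\<Union>c\<in>C. cball c \<epsilon>)" using C(2) by (intro compact_UN) auto
  moreover have "(\<Union>c\<in>C. cball c \<epsilon>) \<subseteq> U" using C(1) \<epsilon>(2) by auto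
  moreover have "q (s x) = 0 \<and> q' (s x) *\<^sub>R s' x = 0" if "x \<notin> (\<Union>c\<in>C. cball c \<epsilon>)" for x
  proof -
    have "s x = 0" "s' x = 0" using that p0 by (auto simp: s_def s'_def intro!: sum.neutral)
    then show ?thesis by (simp add: q_def)
  qed
  ultimately have "C1c_test U (\<lambda>x. q (s x)) (\<lambda>x. q' (s x) *\<^sub>R s' x)"
    unfolding C1c_test_iff by blast
  then show ?thesis
  proof (rule that)
    fix x
    have "max 0 (1 - s x / m) \<le> 1" using s_nonneg[of x] m by simp
    then have "max 0 (1 - s x / m) ^ (0+2) \<le> 1" by (intro power_le_one) auto
    then show "0 \<le> q (s x)" "q (s x) \<le> 1" by (auto simp: q_def)
    show "q (s x) = 1" if "x \<in> K" using x0(2)[OF that] m by (simp add: q_def m_def)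
  qed
qed

section \<open>Almost everywhere sign from test functions\<close>

text \<open>Cutoffs supported in shrinking neighbourhoods of \<open>K\<close> converge pointwise to
  its indicator because \<open>K\<close> is closed. All these neighbourhoods lie in one compact
  \<open>K'\<close> inside \<open>U\<close>, on which \<open>f\<close> is integrable, so dominated
  convergence applies.\<close>

lemma integral_compact_nonneg_of_tests:
  fixes f :: "'a::euclidean_space \<Rightarrow> real"
  assumes U: "open U" and [measurable]: "f \<in> borel_measurable borel"
    and int: "\<And>K. compact K \<Longrightarrow> K \<subseteq> U \<Longrightarrow> set_integrable lborel K f"
    and test: "\<And>\<phi> g. C1c_test U \<phi> g \<Longrightarrow> (\<And>x. 0 \<le> \<phi> x) \<Longrightarrow> 0 \<le> (\<integral>x. f x * \<phi> x \<partial>lborel)"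
    and K: "compact K" "K \<subseteq> U"
  shows "0 \<le> (\<integral>x. f x * indicator K x \<partial>lborel)"
proof (cases "K = {}")
  case False
  obtain \<epsilon> where \<epsilon>: "\<epsilon> > 0" "(\<Union>x\<in>K. cball x \<epsilon>) \<subseteq> U"
    using compact_subset_open_imp_cball_epsilon_subset[OF K(1) U K(2)] by blast
  define K' where "K' = {x. infdist x K \<le> \<epsilon>}"
  have K': "compact K'" unfolding K'_def by (rule compact_infdist_le[OF False K(1) \<epsilon>(1)])
  have K'U: "K' \<subseteq> U"
  proof
    fix x assume "x \<in> K'"
    then have x: "infdist x K \<le> \<epsilon>" by (simp add: K'_def)
    obtain z where "z \<in> K" "infdist x K = dist x z"
      using infdist_attains_inf[OF compact_imp_closed[OF K(1)] False] by blast
    then have "z \<in> K" "x \<in> cball z \<epsilon>" using x by (auto simp: dist_commute)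
    then show "x \<in> U" using \<epsilon>(2) by blast
  qed
  define O' where "O' n = {x. infdist x K < \<epsilon> / real (Suc n)}" for n
  have O_open: "open (O' n)" for n
    unfolding O'_def by (intro open_Collect_less continuous_intros)
  have KO: "K \<subseteq> O' n" for n using \<epsilon>(1) by (auto simp: O'_def)
  have OK': "O' n \<subseteq> K'" for n
  proof
    fix x assume "x \<in> O' n"
    then have "infdist x K < \<epsilon> / real (Suc n)" by (simp add: O'_def)
    also have "\<dots> \<le> \<epsilon>" using \<epsilon>(1) by (simp add: field_simps)
    finally show "x \<in> K'" by (simp add: K'_def)
  qed
  have "\<exists>\<phi> g. C1c_test (O' n) \<phi> g \<and> (\<forall>x. 0 \<le> \<phi> x \<and> \<phi> x \<le> 1 \<and> (x \<in> K \<longrightarrow> \<phi> x = 1))" for n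
    using C1c_cutoff[OF K(1) O_open KO] by metis
  then obtain \<phi> g where \<phi>: "\<And>n. C1c_test (O' n) (\<phi> n) (g n)"
    "\<And>n x. 0 \<le> \<phi> n x" "\<And>n x. \<phi> n x \<le> 1" "\<And>n x. x \<in> K \<Longrightarrow> \<phi> n x = 1" by metis
  have [measurable]: "\<phi> n \<in> borel_measurable borel" for n
    using C1_gradD(4)[OF C1c_test_C1_grad[OF \<phi>(1)]] .
  have out: "\<phi> n x = 0" if "x \<notin> O' n" for n x using C1c_test_outside(1)[OF \<phi>(1) that] .
  have [measurable]: "K \<in> sets borel" "K' \<in> sets borel" using K K' by (auto simp: borel_compact)
  have "(\<lambda>n. \<integral>x. f x * \<phi> n x \<partial>lborel) \<longlonglongrightarrow> (\<integral>x. f x * indicator K x \<partial>lborel)"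
  proof (rule integral_dominated_convergence[where w="\<lambda>x. \<bar>indicator K' x * f x\<bar>"])
    show "integrable lborel (\<lambda>x. \<bar>indicator K' x * f x\<bar>)"
      using int[OF K' K'U] by (simp add: set_integrable_def)
    show "AE x in lborel. (\<lambda>n. f x * \<phi> n x) \<longlonglongrightarrow> f x * indicator K x"
    proof (rule AE_I2)
      fix x
      show "(\<lambda>n. f x * \<phi> n x) \<longlonglongrightarrow> f x * indicator K x"
      proof (cases "x \<in> K")
        case True then show ?thesis using \<phi>(4) by simp
      next
        case xK: False
        then have pos: "infdist x K > 0"
          using in_closed_iff_infdist_zero[OF compact_imp_closed[OF K(1)] False] infdist_nonneg[of x K]
          by (metis less_eq_real_def)
        have "eventually (\<lambda>n. \<epsilon> / real (Suc n) < infdist x K) sequentially"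
          by (rule order_tendstoD(2)[OF _ pos]) (rule LIMSEQ_Suc, rule lim_const_over_n)
        then have "eventually (\<lambda>n. f x * \<phi> n x = f x * indicator K x) sequentially"
          by eventually_elim (use out xK in \<open>auto simp: O'_def\<close>)
        then show ?thesis by (rule tendsto_eventually)
      qed
    qed
    show "AE x in lborel. norm (f x * \<phi> n x) \<le> \<bar>indicator K' x * f x\<bar>" for n
    proof (rule AE_I2)
      fix x
      have "\<bar>f x\<bar> * \<bar>\<phi> n x\<bar> \<le> \<bar>f x\<bar> * indicator K' x"
      proof (rule mult_left_mono)
        show "\<bar>\<phi> n x\<bar> \<le> indicator K' x"
          using \<phi>(2)[of n x] \<phi>(3)[of n x] out[of x n] OK'[of n] by (cases "x \<in> O' n") auto
      qed simp
      then show "norm (f x * \<phi> n x) \<le> \<bar>indicator K' x * f x\<bar>"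
        by (simp add: abs_mult mult.commute)
    qed
  qed auto
  moreover have "0 \<le> (\<integral>x. f x * \<phi> n x \<partial>lborel)" for n
    by (rule test[OF C1c_test_mono[OF \<phi>(1)] \<phi>(2)]) (use OK' K'U in blast)
  ultimately show ?thesis by (meson LIMSEQ_le_const)
qed simp

text \<open>On a compact subset of the set where \<open>f\<close> is negative, the integral of
  \<open>f\<close> is nonpositive and, by the preceding lemma, nonnegative, so the subset is null.
  Exhaustion by balls extends this to closed subsets, and inner regularity to the whole set.\<close>

lemma AE_nonneg_of_tests:
  fixes f :: "'a::euclidean_space \<Rightarrow> real"
  assumes U: "open U" and [measurable]: "f \<in> borel_measurable borel"
    and int: "\<And>K. compact K \<Longrightarrow> K \<subseteq> U \<Longrightarrow> set_integrable lborel K f"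
    and test: "\<And>\<phi> g. C1c_test U \<phi> g \<Longrightarrow> (\<And>x. 0 \<le> \<phi> x) \<Longrightarrow> 0 \<le> (\<integral>x. f x * \<phi> x \<partial>lborel)"
  shows "AE x in lborel. x \<in> U \<longrightarrow> 0 \<le> f x"
proof -
  define A where "A = {x\<in>U. f x < 0}"
  have [measurable]: "U \<in> sets borel" using U by simp
  have A[measurable]: "A \<in> sets borel" unfolding A_def by measurable
  have null: "emeasure lborel K = 0" if K: "compact K" "K \<subseteq> A" for K
  proof -
    have [measurable]: "K \<in> sets borel" using K by (auto simp: borel_compact)
    have KU: "K \<subseteq> U" using K by (auto simp: A_def)
    have "integrable lborel (\<lambda>x. - (f x * indicator K x))"
      using int[OF K(1) KU] by (simp add: set_integrable_def mult.commute)
    moreover have neg: "AE x in lborel. 0 \<le> - (f x * indicator K x)"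
      using K(2) by (intro AE_I2) (auto simp: A_def indicator_def mult_le_0_iff)
    moreover have "(\<integral>x. - (f x * indicator K x) \<partial>lborel) = 0"
    proof (rule antisym)
      show "(\<integral>x. - (f x * indicator K x) \<partial>lborel) \<le> 0"
        using integral_compact_nonneg_of_tests[OF U _ int test K(1) KU] by simp
      show "0 \<le> (\<integral>x. - (f x * indicator K x) \<partial>lborel)" using neg by (rule integral_nonneg_AE)
    qed
    ultimately have "AE x in lborel. - (f x * indicator K x) = 0"
      by (subst (asm) integral_nonneg_eq_0_iff_AE) auto
    then have "AE x in lborel. x \<notin> K"
      by eventually_elim (use K(2) in \<open>auto simp: A_def indicator_def split: if_splits\<close>)
    then show ?thesis by (subst (asm) AE_iff_measurable[of K]) auto
  qed
  have closed_null: "emeasure lborel T = 0" if T: "closed T" "T \<subseteq> A" for T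
  proof -
    have "T = (\<Union>n. T \<inter> cball 0 (real n))"
      using real_arch_simple by auto
    moreover have "emeasure lborel (\<Union>n. T \<inter> cball 0 (real n)) = 0"
    proof (rule emeasure_UN_eq_0)
      show "emeasure lborel (T \<inter> cball 0 (real n)) = 0" for n
        by (rule null) (use T in \<open>auto intro: closed_Int_compact\<close>)
    qed (use T in auto)
    ultimately show ?thesis by simp
  qed
  have "emeasure lborel A \<le> 0"
  proof (rule ennreal_le_epsilon)
    fix e :: real assume "e > 0"
    obtain T where T: "closed T" "T \<subseteq> A" "emeasure lebesgue (A - T) < ennreal e"
      using sets_lebesgue_inner_closed[of A e] A \<open>e > 0\<close> by (metis sets_completionI_sets sets_lborel)
    have "emeasure lborel A \<le> emeasure lborel (A - T) + emeasure lborel T"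
      using T by (metis A Diff_partition Un_commute borel_closed emeasure_subadditive sets.Diff sets_lborel)
    also have "\<dots> \<le> 0 + ennreal e"
      using T closed_null[OF T(1,2)] A by (simp add: less_imp_le borel_closed)
    finally show "emeasure lborel A \<le> 0 + ennreal e" .
  qed
  then have "AE x in lborel. x \<notin> A"
    by (intro AE_not_in) (auto simp: null_sets_def)
  then show ?thesis by eventually_elim (auto simp: A_def)
qed

lemma AE_zero_of_tests:
  fixes f :: "'a::euclidean_space \<Rightarrow> real"
  assumes U: "open U" and f: "f \<in> borel_measurable borel"
    and int: "\<And>K. compact K \<Longrightarrow> K \<subseteq> U \<Longrightarrow> set_integrable lborel K f"
    and test: "\<And>\<phi> g. C1c_test U \<phi> g \<Longrightarrow> (\<integral>x. f x * \<phi> x \<partial>lborel) = 0"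
  shows "AE x in lborel. x \<in> U \<longrightarrow> f x = 0"
proof -
  have "AE x in lborel. x \<in> U \<longrightarrow> 0 \<le> f x"
    by (rule AE_nonneg_of_tests[OF U f int]) (simp_all add: test)
  moreover have "AE x in lborel. x \<in> U \<longrightarrow> 0 \<le> - f x"
    by (rule AE_nonneg_of_tests[OF U]) (use f int in \<open>simp_all add: test set_integrable_def\<close>)
  ultimately show ?thesis by eventually_elim auto
qed

text \<open>The argument behind completeness of L1: along a subsequence with integrals below
  \<open>(1/2)^k\<close> the series converges almost everywhere, so its terms tend to zero and its
  sum \<open>S\<close> is an integrable majorant. This upgrades approximation in the H1 norm to
  pointwise convergence with domination.\<close>

lemma dominated_subsequence:
  fixes d :: "nat \<Rightarrow> 'a \<Rightarrow> real"
  assumes int: "\<And>k. integrable M (d k)" and nn: "\<And>k x. 0 \<le> d k x"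
    and lim: "(\<lambda>k. \<integral>x. d k x \<partial>M) \<longlonglongrightarrow> 0"
  obtains r S where "strict_mono (r :: nat \<Rightarrow> nat)" "integrable M S"
    "AE x in M. (\<lambda>k. d (r k) x) \<longlonglongrightarrow> 0 \<and> (\<forall>k. d (r k) x \<le> S x)"
proof -
  have "\<exists>r. strict_mono (r :: nat \<Rightarrow> nat) \<and> (\<forall>k. (\<integral>x. d (r k) x \<partial>M) < (1/2)^k)"
  proof -
    have ev: "\<exists>N. \<forall>n\<ge>N. (\<integral>x. d n x \<partial>M) < (1/2)^k" for k :: nat
      using order_tendstoD(2)[OF lim, of "(1/2)^k"] by (auto simp: eventually_sequentially)
    have "\<exists>r. \<forall>k. (\<integral>x. d (r k) x \<partial>M) < (1/2)^k \<and> (r k :: nat) < r (Suc k)"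
    proof (rule dependent_nat_choice)
      show "\<exists>n. (\<integral>x. d n x \<partial>M) < (1/2)^0" using ev[of 0] by auto
      fix n k
      obtain N where "\<forall>n\<ge>N. (\<integral>x. d n x \<partial>M) < (1/2)^Suc k" using ev by blast
      then show "\<exists>m. (\<integral>x. d m x \<partial>M) < (1/2)^Suc k \<and> n < m"
        by (intro exI[of _ "max N (Suc n)"]) auto
    qed
    then show ?thesis by (auto simp: strict_mono_Suc_iff)
  qed
  then obtain r where r: "strict_mono (r :: nat \<Rightarrow> nat)" "\<And>k. (\<integral>x. d (r k) x \<partial>M) < (1/2)^k" by blast
  have [measurable]: "d k \<in> borel_measurable M" for k using int by blast
  define S where "S x = (\<Sum>k. d (r k) x)" for x
  have sumI: "summable (\<lambda>k. \<integral>x. norm (d (r k) x) \<partial>M)"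
    using r(2) nn by (intro summable_comparison_test'[OF summable_geometric[of "1/2::real"], of 0])
      (auto simp: less_imp_le)
  have "(\<integral>\<^sup>+x. (\<Sum>k. ennreal (d (r k) x)) \<partial>M) = (\<Sum>k. \<integral>\<^sup>+x. ennreal (d (r k) x) \<partial>M)"
    by (rule nn_integral_suminf) auto
  also have "\<dots> = (\<Sum>k. ennreal (\<integral>x. d (r k) x \<partial>M))"
    using int nn by (intro suminf_cong nn_integral_eq_integral) auto
  also have "\<dots> < \<infinity>"
    using sumI nn by (simp add: ennreal_suminf_neq_top less_top)
  finally have "AE x in M. (\<Sum>k. ennreal (d (r k) x)) \<noteq> \<infinity>"
    by (intro nn_integral_PInf_AE) auto
  then have AEs: "AE x in M. summable (\<lambda>k. d (r k) x)"
    by eventually_elim (use nn summable_suminf_not_top in auto)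
  have "integrable M S" unfolding S_def
    by (rule integrable_suminf) (use int AEs sumI nn in auto)
  moreover have "AE x in M. (\<lambda>k. d (r k) x) \<longlonglongrightarrow> 0 \<and> (\<forall>k. d (r k) x \<le> S x)"
    using AEs
  proof eventually_elim
    case (elim x)
    have "d (r k) x \<le> S x" for k
      unfolding S_def using sum_le_suminf[OF elim, of "{k}"] nn by auto
    then show ?case using summable_LIMSEQ_zero[OF elim] by auto
  qed
  ultimately show ?thesis using that r(1) by blast
qed

section \<open>Truncation of a weak solution\<close>

text \<open>Wanted of \<open>\<beta>\<close>: C1, zero at 0 and positive elsewhere, nondecreasing on
  the positive axis, bounded together with its derivative so that one majorant serves all limits,
  and tending to 1 at infinity so that \<open>\<Lambda>\<close> differs from the identity by a
  bounded amount.\<close>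

definition \<beta> :: "real \<Rightarrow> real" where "\<beta> t = t\<^sup>2 / (1 + t\<^sup>2)"
definition \<beta>' :: "real \<Rightarrow> real" where "\<beta>' t = 2 * t / (1 + t\<^sup>2)\<^sup>2"
text \<open>The antiderivative of \<open>(\<beta> t)\<^sup>2\<close> that vanishes at 0, by partial
  fractions.\<close>

definition \<Lambda> :: "real \<Rightarrow> real" where "\<Lambda> t = t - 3/2 * arctan t + t/2 / (1 + t\<^sup>2)"

lemma one_plus_square_pos: "1 + t\<^sup>2 > 0" "1 + t\<^sup>2 \<noteq> 0" for t :: real
  using zero_le_power2[of t] by linarith+

lemma DERIV_\<beta>: "(\<beta> has_real_derivative \<beta>' t) (at t)"
  unfolding \<beta>_def[abs_def] \<beta>'_def
  by (rule derivative_eq_intros refl | simp add: one_plus_square_pos)+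
     (simp add: one_plus_square_pos field_simps power2_eq_square)

lemma DERIV_\<Lambda>: "(\<Lambda> has_real_derivative (\<beta> t)\<^sup>2) (at t)"
proof -
  have "(\<Lambda> has_real_derivative (1 - 3/2 * (1 / (1 + t\<^sup>2)) + (1/2 * (1 + t\<^sup>2) - t/2 * (2 * t)) / ((1 + t\<^sup>2) * (1 + t\<^sup>2)))) (at t)"
    unfolding \<Lambda>_def[abs_def]
    by (rule derivative_eq_intros refl | simp add: one_plus_square_pos inverse_eq_divide)+
  moreover have "1 - 3/2 * (1 / s) + (1/2 * s - (s - 1)) / (s * s) = ((s - 1) / s)\<^sup>2"
    if "s > 0" for s :: real
    using that by (simp add: field_simps power2_eq_square)
  from this[of "1 + t\<^sup>2"] have "1 - 3/2 * (1 / (1 + t\<^sup>2)) + (1/2 * (1 + t\<^sup>2) - t/2 * (2 * t)) / ((1 + t\<^sup>2) * (1 + t\<^sup>2)) = (\<beta> t)\<^sup>2"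
    using one_plus_square_pos[of t] by (simp add: \<beta>_def power2_eq_square)
  ultimately show ?thesis by simp
qed

lemma continuous_on_\<beta>': "continuous_on UNIV \<beta>'"
  unfolding \<beta>'_def by (intro continuous_intros) (simp add: one_plus_square_pos)

lemma continuous_on_\<beta>: "continuous_on UNIV \<beta>"
  unfolding \<beta>_def by (intro continuous_intros) (simp add: one_plus_square_pos)

lemma continuous_on_\<Lambda>: "continuous_on UNIV \<Lambda>"
  unfolding \<Lambda>_def by (intro continuous_intros ballI one_plus_square_pos) simp_all

lemma measurable_\<beta> [measurable]: "\<beta> \<in> borel_measurable borel" "\<beta>' \<in> borel_measurable borel" "\<Lambda> \<in> borel_measurable borel"
  using continuous_on_\<beta>' continuous_on_\<beta> continuous_on_\<Lambda> by (auto intro: borel_measurable_continuous_onI)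

lemma \<beta>_0 [simp]: "\<beta> 0 = 0" "\<beta>' 0 = 0" "\<Lambda> 0 = 0"
  by (auto simp: \<beta>_def \<beta>'_def \<Lambda>_def)

lemma \<beta>_bounds: "0 \<le> \<beta> t" "\<beta> t \<le> 1" "\<bar>\<beta> t\<bar> \<le> 1" "\<bar>\<beta>' t\<bar> \<le> 1"
proof -
  show 1: "0 \<le> \<beta> t" "\<beta> t \<le> 1" using one_plus_square_pos[of t] by (auto simp: \<beta>_def)
  then show "\<bar>\<beta> t\<bar> \<le> 1" by simp
  have "2 * \<bar>t\<bar> \<le> 1 + t\<^sup>2" using zero_le_power2[of "\<bar>t\<bar> - 1"] by (simp add: power2_eq_square algebra_simps)
  also have "\<dots> \<le> (1 + t\<^sup>2)\<^sup>2" by (rule self_le_power) auto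
  finally show "\<bar>\<beta>' t\<bar> \<le> 1" using one_plus_square_pos[of t] by (simp add: \<beta>'_def abs_mult)
qed

lemma \<beta>_pos: "t \<noteq> 0 \<Longrightarrow> 0 < \<beta> t"
  using one_plus_square_pos[of t] by (auto simp: \<beta>_def)

lemma \<beta>'_nonneg: "0 \<le> t \<Longrightarrow> 0 \<le> \<beta>' t"
  by (auto simp: \<beta>'_def)

text \<open>The three summands contribute 1, 3/2 and 1/2. Linear growth carries integrability over
  from \<open>W\<close>.\<close>

lemma abs_\<Lambda>_le: "\<bar>\<Lambda> t\<bar> \<le> 3 * \<bar>t\<bar>"
proof -
  have "\<bar>t/2 / (1 + t\<^sup>2)\<bar> = \<bar>t/2\<bar> / (1 + t\<^sup>2)"
    using one_plus_square_pos[of t] by (simp add: abs_mult)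
  also have "\<dots> \<le> \<bar>t/2\<bar>" using mult_left_mono[of 1 "1 + t\<^sup>2" "\<bar>t/2\<bar>"]
    unfolding pos_divide_le_eq[OF one_plus_square_pos(1)] by simp
  finally show ?thesis using abs_arctan_le[of t] unfolding \<Lambda>_def by linarith
qed

text \<open>Only \<open>3/2 * arctan t\<close> is lost, and \<open>arctan t < 2\<close>. This turns
  an upper bound for \<open>\<Lambda> t\<close> into one for \<open>t\<close>.\<close>

lemma \<Lambda>_ge: assumes "0 \<le> t" shows "t - 3 \<le> \<Lambda> t"
proof -
  have "0 \<le> t/2 / (1 + t\<^sup>2)" using assms one_plus_square_pos[of t] by simp
  moreover have "arctan t < 2" using arctan_ubound[of t] pi_less_4 by linarith
  ultimately show ?thesis unfolding \<Lambda>_def by linarith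
qed

lemma integrable_lborel_bound:
  fixes f :: "'a::euclidean_space \<Rightarrow> 'b::{banach, second_countable_topology}"
  assumes "integrable lborel w" "f \<in> borel_measurable borel" "AE x in lborel. norm (f x) \<le> (w x::real)"
  shows "integrable lborel f"
  by (rule Bochner_Integration.integrable_bound[OF assms(1)]) (use assms in auto)

text \<open>L2 embeds into L1 on a set of finite measure, here through
  \<open>norm (F x) \<le> (norm (F x))\<^sup>2 + 1\<close>.\<close>

lemma integrable_sq_imp:
  assumes "integrable lborel (\<lambda>x. indicator K x * (norm (F (x::'a::euclidean_space) :: 'b::euclidean_space))\<^sup>2)" "compact K" "F \<in> borel_measurable borel"
  shows "integrable lborel (\<lambda>x. indicator K x *\<^sub>R F x)"
proof -
  have [measurable]: "K \<in> sets borel" "F \<in> borel_measurable borel" using assms by (auto simp: borel_compact)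
  have w: "integrable lborel (\<lambda>x. indicator K x * (norm (F x))\<^sup>2 + 1 * indicator K x)"
    using integrable_indicator_compact[OF assms(2), of 1] assms(1) by (intro Bochner_Integration.integrable_add) auto
  have "norm (indicator K x *\<^sub>R F x) \<le> indicator K x * (norm (F x))\<^sup>2 + 1 * indicator K x" for x
  proof -
    have "0 \<le> (norm (F x) - 1)\<^sup>2" "0 \<le> norm (F x)" by simp_all
    then have "norm (F x) \<le> (norm (F x))\<^sup>2 + 1" unfolding power2_diff one_power2 mult_1_right by linarith
    then show ?thesis by (cases "x \<in> K") auto
  qed
  then show ?thesis by (intro integrable_lborel_bound[OF w]) auto
qed

text \<open>The data of a weak solution \<open>u\<close> with gradient \<open>G\<close> and right-hand side \<open>f\<close>, all extended by zero
  outside \<open>\<Omega>\<close>, and of a function \<open>W\<close> with gradient \<open>\<Gamma>\<close> that equals \<open>(u - 1)\<^sup>+\<close> in \<open>\<Omega> \<inter> B\<close> and is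
  the limit of the test functions \<open>\<phi> k\<close>, with a square integrable majorant \<open>D\<close>.\<close>

locale truncated_solution =
  fixes \<Omega> B :: "'a::euclidean_space set" and u f W D :: "'a \<Rightarrow> real" and G \<Gamma> :: "'a \<Rightarrow> 'a"
    and \<phi> :: "nat \<Rightarrow> 'a \<Rightarrow> real" and g :: "nat \<Rightarrow> 'a \<Rightarrow> 'a"
  assumes open_\<Omega>: "open \<Omega>" and open_B: "open B"
    and meas: "u \<in> borel_measurable borel" "f \<in> borel_measurable borel" "W \<in> borel_measurable borel"
      "D \<in> borel_measurable borel" "G \<in> borel_measurable borel" "\<Gamma> \<in> borel_measurable borel"
    and u_L2: "\<And>K. compact K \<Longrightarrow> K \<subseteq> \<Omega> \<Longrightarrow> integrable lborel (\<lambda>x. indicator K x * (u x)\<^sup>2)"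
    and G_L2: "\<And>K. compact K \<Longrightarrow> K \<subseteq> \<Omega> \<Longrightarrow> integrable lborel (\<lambda>x. indicator K x * (norm (G x))\<^sup>2)"
    and f_L1: "\<And>K. compact K \<Longrightarrow> K \<subseteq> \<Omega> \<Longrightarrow> integrable lborel (\<lambda>x. indicator K x * f x)"
    and f_le: "\<And>x. x \<in> \<Omega> \<Longrightarrow> 1 < u x \<Longrightarrow> f x \<le> 1"
    and u_grad: "\<And>\<zeta> h. C1c_test \<Omega> \<zeta> h \<Longrightarrow> (\<integral>x. u x *\<^sub>R h x \<partial>lborel) = - (\<integral>x. \<zeta> x *\<^sub>R G x \<partial>lborel)"
    and u_eq: "\<And>\<zeta> h. C1c_test \<Omega> \<zeta> h \<Longrightarrow> (\<integral>x. G x \<bullet> h x \<partial>lborel) = (\<integral>x. f x * \<zeta> x \<partial>lborel)"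
    and W_grad: "\<And>\<zeta> h. C1c_test \<Omega> \<zeta> h \<Longrightarrow> (\<integral>x. W x *\<^sub>R h x \<partial>lborel) = - (\<integral>x. \<zeta> x *\<^sub>R \<Gamma> x \<partial>lborel)"
    and W_eq: "\<And>x. x \<in> \<Omega> \<inter> B \<Longrightarrow> W x = max (u x - 1) 0"
    and W_nonneg: "\<And>x. 0 \<le> W x"
    and test_\<phi>: "\<And>k. C1c_test \<Omega> (\<phi> k) (g k)"
    and D_L2: "integrable lborel (\<lambda>x. (D x)\<^sup>2)"
    and approx: "AE x in lborel. (\<lambda>k. \<phi> k x) \<longlonglongrightarrow> W x \<and> (\<lambda>k. g k x) \<longlonglongrightarrow> \<Gamma> x \<and>
      (\<forall>k. \<bar>\<phi> k x\<bar> \<le> D x \<and> norm (g k x) \<le> D x)"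
begin

lemma meas_\<phi>: "\<phi> k \<in> borel_measurable borel" "g k \<in> borel_measurable borel"
  using C1_gradD(4,5)[OF C1c_test_C1_grad[OF test_\<phi>]] by auto

lemmas [measurable] = meas meas_\<phi>

lemma majorant: "AE x in lborel. \<bar>W x\<bar> \<le> D x \<and> norm (\<Gamma> x) \<le> D x"
  using approx
proof eventually_elim
  case (elim x)
  have "\<bar>W x\<bar> \<le> D x" by (rule Lim_bounded[of "\<lambda>k. \<bar>\<phi> k x\<bar>" _ 0]) (use elim in \<open>auto intro: tendsto_rabs\<close>)
  moreover have "norm (\<Gamma> x) \<le> D x"
    by (rule Lim_bounded[of "\<lambda>k. norm (g k x)" _ 0]) (use elim in \<open>auto intro: tendsto_norm\<close>)
  ultimately show ?case by simp
qed

lemma W_L2: "integrable lborel (\<lambda>x. (W x)\<^sup>2)" and \<Gamma>_L2: "integrable lborel (\<lambda>x. (norm (\<Gamma> x))\<^sup>2)"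
proof -
  show "integrable lborel (\<lambda>x. (W x)\<^sup>2)"
    by (rule integrable_lborel_bound[OF D_L2], simp)
       (use majorant in eventually_elim, auto simp: abs_le_square_iff[symmetric])
  show "integrable lborel (\<lambda>x. (norm (\<Gamma> x))\<^sup>2)"
    by (rule integrable_lborel_bound[OF D_L2], simp)
       (use majorant in eventually_elim, auto simp: abs_le_square_iff[symmetric])
qed

lemma tendsto_\<beta>:
  assumes "(\<lambda>k. \<phi> k x) \<longlonglongrightarrow> W x"
  shows "(\<lambda>k. \<beta> (\<phi> k x)) \<longlonglongrightarrow> \<beta> (W x)" "(\<lambda>k. \<beta>' (\<phi> k x)) \<longlonglongrightarrow> \<beta>' (W x)" "(\<lambda>k. \<Lambda> (\<phi> k x)) \<longlonglongrightarrow> \<Lambda> (W x)"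
  using continuous_on_tendsto_compose[OF continuous_on_\<beta> assms] continuous_on_tendsto_compose[OF continuous_on_\<beta>' assms]
    continuous_on_tendsto_compose[OF continuous_on_\<Lambda> assms] by auto

section \<open>Limits of integrals against \<open>\<beta> (\<phi> j x) * \<xi> x\<close> and its
  gradient\<close>

text \<open>The second factor is the gradient of \<open>\<beta> (\<phi> j x) * \<xi> x\<close>. On
  the support of \<open>\<xi>\<close> the integrand is dominated by a multiple of the sum of
  \<open>(norm (F x))\<^sup>2\<close>, \<open>(D x)\<^sup>2\<close> and 1. The set \<open>V\<close>
  is left free: it is \<open>\<Omega>\<close> for fields such as \<open>G\<close> that are
  controlled only locally there, and \<open>B\<close> for fields controlled up to the
  boundary.\<close>

lemma lim_test_grad:
  assumes \<xi>: "C1c_test V \<xi> \<xi>'" and [measurable]: "F \<in> borel_measurable borel"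
    and F: "\<And>K. compact K \<Longrightarrow> K \<subseteq> V \<Longrightarrow> integrable lborel (\<lambda>x. indicator K x * (norm (F x :: 'a))\<^sup>2)"
  shows "(\<lambda>j. \<integral>x. F x \<bullet> (\<beta> (\<phi> j x) *\<^sub>R \<xi>' x + \<xi> x *\<^sub>R (\<beta>' (\<phi> j x) *\<^sub>R g j x)) \<partial>lborel)
      \<longlonglongrightarrow> (\<integral>x. F x \<bullet> (\<beta> (W x) *\<^sub>R \<xi>' x + \<xi> x *\<^sub>R (\<beta>' (W x) *\<^sub>R \<Gamma> x)) \<partial>lborel)" (is "?L1 \<longlonglongrightarrow> ?L2")
    and "integrable lborel (\<lambda>x. F x \<bullet> (\<beta> (W x) *\<^sub>R \<xi>' x + \<xi> x *\<^sub>R (\<beta>' (W x) *\<^sub>R \<Gamma> x)))"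
    and "integrable lborel (\<lambda>x. F x \<bullet> (\<beta> (\<phi> j x) *\<^sub>R \<xi>' x + \<xi> x *\<^sub>R (\<beta>' (\<phi> j x) *\<^sub>R g j x)))"
proof -
  note C1 = C1c_test_C1_grad[OF \<xi>]
  have [measurable]: "\<xi> \<in> borel_measurable borel" "\<xi>' \<in> borel_measurable borel" using C1_gradD[OF C1] by auto
  obtain K where K: "compact K" "K \<subseteq> V" "\<And>x. x \<notin> K \<Longrightarrow> \<xi> x = 0" "\<And>x. x \<notin> K \<Longrightarrow> \<xi>' x = 0"
    using C1c_test_supportE[OF \<xi>] by metis
  have [measurable]: "K \<in> sets borel" using K by (simp add: borel_compact)
  obtain C1 where C1: "C1 > 0" "\<And>x. norm (\<xi> x) \<le> C1 * indicator K x"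
    using continuous_compact_support_bounded[OF C1_gradD(3)[OF C1] K(1,3)] by blast
  obtain C2 where C2: "C2 > 0" "\<And>x. norm (\<xi>' x) \<le> C2 * indicator K x"
    using continuous_compact_support_bounded[OF C1_gradD(2)[OF C1c_test_C1_grad[OF \<xi>]] K(1,4)] by blast
  define w where "w x = C2 * (indicator K x * (norm (F x))\<^sup>2 + indicator K x) +
      C1 * (indicator K x * (norm (F x))\<^sup>2 + (D x)\<^sup>2)" for x
  have w: "integrable lborel w" unfolding w_def
    using F[OF K(1,2)] D_L2 integrable_indicator_compact[OF K(1), of 1]
    by (intro Bochner_Integration.integrable_add integrable_mult_right) auto
  have bound: "norm (F x \<bullet> (a *\<^sub>R \<xi>' x + \<xi> x *\<^sub>R (b *\<^sub>R v))) \<le> w x"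
    if "\<bar>a\<bar> \<le> 1" "\<bar>b\<bar> \<le> 1" "norm v \<le> D x" for a b v x
  proof (cases "x \<in> K")
    case True
    have am: "p * q \<le> p\<^sup>2 + q\<^sup>2" for p q :: real
    proof -
      have "0 \<le> (p - q)\<^sup>2" "0 \<le> p\<^sup>2" "0 \<le> q\<^sup>2" by simp_all
      moreover have "2 * p * q = 2 * (p * q)" by simp
      ultimately show ?thesis unfolding power2_diff by linarith
    qed
    have 1: "norm (F x) * norm (a *\<^sub>R \<xi>' x) \<le> C2 * ((norm (F x))\<^sup>2 + 1)"
    proof -
      have "norm (a *\<^sub>R \<xi>' x) \<le> 1 * C2" unfolding norm_scaleR
        using that(1) C2(2)[of x] True by (intro mult_mono) auto
      then have "norm (F x) * norm (a *\<^sub>R \<xi>' x) \<le> norm (F x) * C2" by (intro mult_left_mono) auto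
      also have "\<dots> = C2 * (norm (F x) * 1)" by simp
      also have "\<dots> \<le> C2 * ((norm (F x))\<^sup>2 + 1\<^sup>2)" using C2(1) am[of "norm (F x)" 1] by (intro mult_left_mono) auto
      finally show ?thesis by simp
    qed
    have 2: "norm (F x) * norm (\<xi> x *\<^sub>R (b *\<^sub>R v)) \<le> C1 * ((norm (F x))\<^sup>2 + (D x)\<^sup>2)"
    proof -
      have D0: "0 \<le> D x" using that(3) norm_ge_zero order_trans by blast
      have "norm (b *\<^sub>R v) \<le> 1 * D x" unfolding norm_scaleR
        using that(2,3) by (intro mult_mono) auto
      then have "norm (\<xi> x *\<^sub>R (b *\<^sub>R v)) \<le> C1 * (1 * D x)" unfolding norm_scaleR[of "\<xi> x"]
        using C1(1) C1(2)[of x] True by (intro mult_mono) auto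
      then have "norm (F x) * norm (\<xi> x *\<^sub>R (b *\<^sub>R v)) \<le> norm (F x) * (C1 * D x)" by (intro mult_left_mono) auto
      also have "\<dots> = C1 * (norm (F x) * D x)" by simp
      also have "\<dots> \<le> C1 * ((norm (F x))\<^sup>2 + (D x)\<^sup>2)" using C1(1) am by (intro mult_left_mono) auto
      finally show ?thesis .
    qed
    have "norm (F x \<bullet> (a *\<^sub>R \<xi>' x + \<xi> x *\<^sub>R (b *\<^sub>R v))) \<le> norm (F x) * norm (a *\<^sub>R \<xi>' x + \<xi> x *\<^sub>R (b *\<^sub>R v))"
      using Cauchy_Schwarz_ineq2 by simp
    also have "\<dots> \<le> norm (F x) * (norm (a *\<^sub>R \<xi>' x) + norm (\<xi> x *\<^sub>R (b *\<^sub>R v)))"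
      by (intro mult_left_mono norm_triangle_ineq) simp
    also have "\<dots> \<le> C2 * ((norm (F x))\<^sup>2 + 1) + C1 * ((norm (F x))\<^sup>2 + (D x)\<^sup>2)"
      unfolding distrib_left[of "norm (F x)"] by (intro add_mono 1 2)
    also have "\<dots> = w x" using True by (simp add: w_def)
    finally show ?thesis .
  next
    case False then show ?thesis using K C1(1) by (simp add: w_def)
  qed
  have b1: "AE x in lborel. norm (F x \<bullet> (\<beta> (\<phi> j x) *\<^sub>R \<xi>' x + \<xi> x *\<^sub>R (\<beta>' (\<phi> j x) *\<^sub>R g j x))) \<le> w x" for j
    using approx by eventually_elim (intro bound \<beta>_bounds, auto)
  have b2: "AE x in lborel. norm (F x \<bullet> (\<beta> (W x) *\<^sub>R \<xi>' x + \<xi> x *\<^sub>R (\<beta>' (W x) *\<^sub>R \<Gamma> x))) \<le> w x"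
    using majorant by eventually_elim (intro bound \<beta>_bounds, auto)
  show "?L1 \<longlonglongrightarrow> ?L2"
  proof (rule integral_dominated_convergence[OF _ _ w _ b1])
    show "AE x in lborel. (\<lambda>j. F x \<bullet> (\<beta> (\<phi> j x) *\<^sub>R \<xi>' x + \<xi> x *\<^sub>R (\<beta>' (\<phi> j x) *\<^sub>R g j x)))
       \<longlonglongrightarrow> F x \<bullet> (\<beta> (W x) *\<^sub>R \<xi>' x + \<xi> x *\<^sub>R (\<beta>' (W x) *\<^sub>R \<Gamma> x))"
      using approx by eventually_elim (intro tendsto_intros tendsto_\<beta>, auto)
  qed auto
  show "integrable lborel (\<lambda>x. F x \<bullet> (\<beta> (W x) *\<^sub>R \<xi>' x + \<xi> x *\<^sub>R (\<beta>' (W x) *\<^sub>R \<Gamma> x)))"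
    by (rule integrable_lborel_bound[OF w _ b2]) simp
  show "integrable lborel (\<lambda>x. F x \<bullet> (\<beta> (\<phi> j x) *\<^sub>R \<xi>' x + \<xi> x *\<^sub>R (\<beta>' (\<phi> j x) *\<^sub>R g j x)))"
    by (rule integrable_lborel_bound[OF w _ b1]) simp
qed

text \<open>The counterpart without derivatives: since \<open>\<beta>\<close> is bounded by 1, local
  integrability of \<open>h\<close> is enough, which is all that is assumed of the right-hand side
  \<open>f\<close>.\<close>

lemma lim_test:
  assumes \<xi>: "C1c_test V \<xi> \<xi>'" and [measurable]: "h \<in> borel_measurable borel"
    and h: "\<And>K. compact K \<Longrightarrow> K \<subseteq> V \<Longrightarrow> integrable lborel (\<lambda>x. indicator K x * h x)"
  shows "(\<lambda>j. \<integral>x. h x * (\<beta> (\<phi> j x) * \<xi> x) \<partial>lborel) \<longlonglongrightarrow> (\<integral>x. h x * (\<beta> (W x) * \<xi> x) \<partial>lborel)" (is "?L1 \<longlonglongrightarrow> ?L2")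
    and "integrable lborel (\<lambda>x. h x * (\<beta> (W x) * \<xi> x))"
    and "integrable lborel (\<lambda>x. h x * (\<beta> (\<phi> j x) * \<xi> x))"
proof -
  note C1 = C1c_test_C1_grad[OF \<xi>]
  have [measurable]: "\<xi> \<in> borel_measurable borel" using C1_gradD[OF C1] by auto
  obtain K where K: "compact K" "K \<subseteq> V" "\<And>x. x \<notin> K \<Longrightarrow> \<xi> x = 0"
    using C1c_test_supportE[OF \<xi>] by metis
  obtain C where C: "C > 0" "\<And>x. norm (\<xi> x) \<le> C * indicator K x"
    using continuous_compact_support_bounded[OF C1_gradD(3)[OF C1] K(1,3)] by blast
  define w where "w x = C * \<bar>indicator K x * h x\<bar>" for x
  have w: "integrable lborel w" unfolding w_def using h[OF K(1,2)] by auto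
  have b: "norm (h x * (\<beta> t * \<xi> x)) \<le> w x" for x t
  proof -
    have "\<bar>\<beta> t\<bar> * \<bar>\<xi> x\<bar> \<le> 1 * (C * indicator K x)" using \<beta>_bounds(3) C(2)[of x] by (intro mult_mono) auto
    then have "\<bar>h x\<bar> * (\<bar>\<beta> t\<bar> * \<bar>\<xi> x\<bar>) \<le> \<bar>h x\<bar> * (C * indicator K x)" by (intro mult_left_mono) auto
    then show ?thesis by (simp add: w_def abs_mult mult_ac)
  qed
  show "?L1 \<longlonglongrightarrow> ?L2"
  proof (rule integral_dominated_convergence[OF _ _ w])
    show "AE x in lborel. (\<lambda>j. h x * (\<beta> (\<phi> j x) * \<xi> x)) \<longlonglongrightarrow> h x * (\<beta> (W x) * \<xi> x)"
      using approx by eventually_elim (intro tendsto_intros tendsto_\<beta>, auto)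
  qed (use b in auto)
  show "integrable lborel (\<lambda>x. h x * (\<beta> (W x) * \<xi> x))"
    by (rule integrable_lborel_bound[OF w]) (use b in auto)
  show "integrable lborel (\<lambda>x. h x * (\<beta> (\<phi> j x) * \<xi> x))"
    by (rule integrable_lborel_bound[OF w]) (use b in auto)
qed

lemma C1c_test_\<beta>\<phi>: "C1c_test \<Omega> (\<lambda>x. \<beta> (\<phi> k x)) (\<lambda>x. \<beta>' (\<phi> k x) *\<^sub>R g k x)"
  by (rule C1c_test_compose[OF test_\<phi> DERIV_\<beta> continuous_on_\<beta>']) simp

lemma C1c_test_\<beta>\<phi>_mult:
  assumes "C1c_test V \<xi> \<xi>'"
  shows "C1c_test (\<Omega> \<inter> V) (\<lambda>x. \<beta> (\<phi> j x) * \<xi> x) (\<lambda>x. \<beta> (\<phi> j x) *\<^sub>R \<xi>' x + \<xi> x *\<^sub>R (\<beta>' (\<phi> j x) *\<^sub>R g j x))"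
  by (rule C1c_test_mult[OF C1c_test_\<beta>\<phi> assms])

text \<open>Testing both weak gradients with \<open>\<beta> (\<phi> j) \<xi>\<close>: in the limit \<open>u - W = 1\<close> wherever
  \<open>\<beta> W\<close> or \<open>\<beta>' W\<close> is nonzero, so the difference is the integral of a gradient.\<close>

lemma gradient_eq: "AE x in lborel. x \<in> \<Omega> \<inter> B \<longrightarrow> W x \<noteq> 0 \<longrightarrow> G x = \<Gamma> x"
proof -
  \<comment> \<open>The set where \<open>W\<close> is nonzero need not be open, so test functions
    cannot be localised to it; the weight \<open>\<beta> (W x)\<close> does the localisation
    instead.\<close>
  have comp: "AE x in lborel. x \<in> \<Omega> \<inter> B \<longrightarrow> \<beta> (W x) * ((G x - \<Gamma> x) \<bullet> b) = 0" if b: "b \<in> Basis" for b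
  proof (rule AE_zero_of_tests)
    have loc: "integrable lborel (\<lambda>x. indicator K x * ((G x - \<Gamma> x) \<bullet> b))" if K: "compact K" "K \<subseteq> \<Omega>" for K
    proof -
      have [measurable]: "K \<in> sets borel" using K by (auto simp: borel_compact)
      have "integrable lborel (\<lambda>x. indicator K x *\<^sub>R G x)" using integrable_sq_imp[OF G_L2 K(1)] K by simp
      moreover have "integrable lborel (\<lambda>x. indicator K x *\<^sub>R \<Gamma> x)"
        by (rule integrable_sq_imp[OF _ K(1)])
           (auto intro!: integrable_lborel_bound[OF \<Gamma>_L2] simp: indicator_def)
      ultimately have "integrable lborel (\<lambda>x. (indicator K x *\<^sub>R G x - indicator K x *\<^sub>R \<Gamma> x) \<bullet> b)"
        by (intro integrable_inner_left Bochner_Integration.integrable_diff)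
      then show ?thesis by (simp add: inner_diff_left right_diff_distrib)
    qed
    show "set_integrable lborel K (\<lambda>x. \<beta> (W x) * ((G x - \<Gamma> x) \<bullet> b))" if K: "compact K" "K \<subseteq> \<Omega> \<inter> B" for K
    proof -
      have [measurable]: "K \<in> sets borel" using K by (auto simp: borel_compact)
      have "integrable lborel (\<lambda>x. \<bar>indicator K x * ((G x - \<Gamma> x) \<bullet> b)\<bar>)" using loc[of K] K by auto
      then show ?thesis unfolding set_integrable_def
        by (rule integrable_lborel_bound)
           (use \<beta>_bounds in \<open>auto simp: abs_mult indicator_def intro!: mult_left_le_one_le\<close>)
    qed
    show "(\<integral>x. \<beta> (W x) * ((G x - \<Gamma> x) \<bullet> b) * \<xi> x \<partial>lborel) = 0" if \<xi>: "C1c_test (\<Omega> \<inter> B) \<xi> \<xi>'" for \<xi> \<xi>'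
    proof -
      have \<xi>\<Omega>: "C1c_test \<Omega> \<xi> \<xi>'" using C1c_test_mono[OF \<xi>] by blast
      define h where "h j x = \<beta> (\<phi> j x) *\<^sub>R \<xi>' x + \<xi> x *\<^sub>R (\<beta>' (\<phi> j x) *\<^sub>R g j x)" for j x
      define H where "H x = \<beta> (W x) *\<^sub>R \<xi>' x + \<xi> x *\<^sub>R (\<beta>' (W x) *\<^sub>R \<Gamma> x)" for x
      have test: "C1c_test \<Omega> (\<lambda>x. \<beta> (\<phi> j x) * \<xi> x) (h j)" for j
        using C1c_test_\<beta>\<phi>_mult[OF \<xi>\<Omega>, of j] by (simp add: h_def[abs_def])
      define m where "m x = u x - W x" for x
      have [measurable]: "m \<in> borel_measurable borel" by (simp add: m_def[abs_def])
      have m_L2: "integrable lborel (\<lambda>x. indicator K x * (norm (m x *\<^sub>R b))\<^sup>2)" if K: "compact K" "K \<subseteq> \<Omega>" for K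
      proof -
        have [measurable]: "K \<in> sets borel" using K by (auto simp: borel_compact)
        have w: "integrable lborel (\<lambda>x. 2 * (indicator K x * (u x)\<^sup>2) + 2 * (W x)\<^sup>2)"
          using u_L2[OF K] W_L2 by auto
        have "norm (indicator K x * (norm (m x *\<^sub>R b))\<^sup>2) \<le> 2 * (indicator K x * (u x)\<^sup>2) + 2 * (W x)\<^sup>2" for x
        proof (cases "x \<in> K")
          case True
          have "0 \<le> (u x + W x)\<^sup>2" by simp
          have "norm (m x *\<^sub>R b) = \<bar>u x - W x\<bar>" using b by (simp add: m_def)
          then have n: "(norm (m x *\<^sub>R b))\<^sup>2 = (u x - W x)\<^sup>2" by simp
          have "(u x - W x)\<^sup>2 \<le> 2 * (u x)\<^sup>2 + 2 * (W x)\<^sup>2"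
            using \<open>0 \<le> (u x + W x)\<^sup>2\<close> unfolding power2_sum power2_diff by linarith
          then show ?thesis using True unfolding n by simp
        qed simp
        then show ?thesis by (intro integrable_lborel_bound[OF w]) auto
      qed
      \<comment> \<open>Subtracting the two weak gradient identities requires each integral to
        exist; the test function has compact support in \<open>\<Omega>\<close>, where the local
        bounds give this.\<close>
      have im: "(\<integral>x. (m x *\<^sub>R b) \<bullet> h j x \<partial>lborel) = - (\<integral>x. ((G x - \<Gamma> x) \<bullet> b) * (\<beta> (\<phi> j x) * \<xi> x) \<partial>lborel)" for j
      proof -
        obtain K where K: "compact K" "K \<subseteq> \<Omega>" "\<And>x. x \<notin> K \<Longrightarrow> \<beta> (\<phi> j x) * \<xi> x = 0" "\<And>x. x \<notin> K \<Longrightarrow> h j x = 0"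
          using C1c_test_supportE[OF test[of j]] by metis
        note C = C1c_test_C1_grad[OF test[of j]]
        obtain C1 where C1: "C1 > 0" "\<And>x. norm (\<beta> (\<phi> j x) * \<xi> x) \<le> C1 * indicator K x"
          using continuous_compact_support_bounded[OF C1_gradD(3)[OF C] K(1,3)] by blast
        obtain C2 where C2: "C2 > 0" "\<And>x. norm (h j x) \<le> C2 * indicator K x"
          using continuous_compact_support_bounded[OF C1_gradD(2)[OF C] K(1,4)] by blast
        have [measurable]: "h j \<in> borel_measurable borel" "(\<lambda>x. \<beta> (\<phi> j x) * \<xi> x) \<in> borel_measurable borel"
          using C1_gradD[OF C] by auto
        have [measurable]: "K \<in> sets borel" using K by (auto simp: borel_compact)
        have sc: "integrable lborel (\<lambda>x. k x *\<^sub>R h j x)"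
          if "integrable lborel (\<lambda>x. indicator K x * (k x)\<^sup>2)" and [measurable]: "k \<in> borel_measurable borel" for k :: "'a \<Rightarrow> real"
        proof -
          have "integrable lborel (\<lambda>x. indicator K x *\<^sub>R k x)" using integrable_sq_imp[OF _ K(1), of k] that by simp
          then have w: "integrable lborel (\<lambda>x. C2 * \<bar>indicator K x * k x\<bar>)" by simp
          show ?thesis
          proof (rule integrable_lborel_bound[OF w])
            have "\<bar>k x\<bar> * norm (h j x) \<le> \<bar>k x\<bar> * (C2 * indicator K x)" for x
              using C2(2) by (intro mult_left_mono) auto
            then show "AE x in lborel. norm (k x *\<^sub>R h j x) \<le> C2 * \<bar>indicator K x * k x\<bar>"
              by (auto simp: abs_mult mult_ac)
          qed simp
        qed
        have sv: "integrable lborel (\<lambda>x. (\<beta> (\<phi> j x) * \<xi> x) *\<^sub>R F x)"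
          if "integrable lborel (\<lambda>x. indicator K x * (norm (F x))\<^sup>2)" and [measurable]: "F \<in> borel_measurable borel" for F :: "'a \<Rightarrow> 'a"
        proof -
          have "integrable lborel (\<lambda>x. indicator K x *\<^sub>R F x)" using integrable_sq_imp[OF _ K(1), of F] that by simp
          then have w: "integrable lborel (\<lambda>x. C1 * norm (indicator K x *\<^sub>R F x))" by (intro integrable_mult_right integrable_norm)
          show ?thesis
          proof (rule integrable_lborel_bound[OF w])
            have "norm (\<beta> (\<phi> j x) * \<xi> x) * norm (F x) \<le> C1 * indicator K x * norm (F x)" for x
              using C1(2) by (intro mult_right_mono) auto
            then show "AE x in lborel. norm ((\<beta> (\<phi> j x) * \<xi> x) *\<^sub>R F x) \<le> C1 * norm (indicator K x *\<^sub>R F x)"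
              by (auto simp: mult_ac)
          qed simp
        qed
        have iW: "integrable lborel (\<lambda>x. indicator K x * (W x)\<^sup>2)" "integrable lborel (\<lambda>x. indicator K x * (norm (\<Gamma> x))\<^sup>2)"
          by (rule integrable_lborel_bound[OF W_L2]; auto simp: indicator_def)
             (rule integrable_lborel_bound[OF \<Gamma>_L2]; auto simp: indicator_def)
        have iu: "integrable lborel (\<lambda>x. u x *\<^sub>R h j x)" "integrable lborel (\<lambda>x. W x *\<^sub>R h j x)"
          using sc[OF u_L2[OF K(1,2)]] sc[OF iW(1)] by auto
        have iG: "integrable lborel (\<lambda>x. (\<beta> (\<phi> j x) * \<xi> x) *\<^sub>R G x)" "integrable lborel (\<lambda>x. (\<beta> (\<phi> j x) * \<xi> x) *\<^sub>R \<Gamma> x)"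
          using sv[OF G_L2[OF K(1,2)]] sv[OF iW(2)] by auto
        have "(\<integral>x. (m x *\<^sub>R b) \<bullet> h j x \<partial>lborel) = (\<integral>x. (u x *\<^sub>R h j x - W x *\<^sub>R h j x) \<bullet> b \<partial>lborel)"
          by (simp add: m_def inner_commute[of b] algebra_simps)
        also have "\<dots> = ((\<integral>x. u x *\<^sub>R h j x \<partial>lborel) - (\<integral>x. W x *\<^sub>R h j x \<partial>lborel)) \<bullet> b"
          using iu by (subst integral_inner_left) (auto simp: Bochner_Integration.integral_diff)
        also have "\<dots> = - (((\<integral>x. (\<beta> (\<phi> j x) * \<xi> x) *\<^sub>R G x \<partial>lborel) - (\<integral>x. (\<beta> (\<phi> j x) * \<xi> x) *\<^sub>R \<Gamma> x \<partial>lborel)) \<bullet> b)"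
          using u_grad[OF test[of j]] W_grad[OF test[of j]] by (simp add: inner_diff_left)
        also have "\<dots> = - (\<integral>x. ((\<beta> (\<phi> j x) * \<xi> x) *\<^sub>R G x - (\<beta> (\<phi> j x) * \<xi> x) *\<^sub>R \<Gamma> x) \<bullet> b \<partial>lborel)"
          using iG by (subst integral_inner_left) (auto simp: Bochner_Integration.integral_diff)
        also have "\<dots> = - (\<integral>x. ((G x - \<Gamma> x) \<bullet> b) * (\<beta> (\<phi> j x) * \<xi> x) \<partial>lborel)"
          by (simp add: algebra_simps)
        finally show ?thesis .
      qed
      have "(\<lambda>j. \<integral>x. (m x *\<^sub>R b) \<bullet> h j x \<partial>lborel) \<longlonglongrightarrow> (\<integral>x. (m x *\<^sub>R b) \<bullet> H x \<partial>lborel)"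
        unfolding h_def H_def by (rule lim_test_grad(1)[OF \<xi>\<Omega> _ m_L2]) auto
      moreover have "(\<lambda>j. \<integral>x. ((G x - \<Gamma> x) \<bullet> b) * (\<beta> (\<phi> j x) * \<xi> x) \<partial>lborel) \<longlonglongrightarrow> (\<integral>x. ((G x - \<Gamma> x) \<bullet> b) * (\<beta> (W x) * \<xi> x) \<partial>lborel)"
        by (rule lim_test(1)[OF \<xi>\<Omega> _ loc]) auto
      ultimately have eq: "(\<integral>x. (m x *\<^sub>R b) \<bullet> H x \<partial>lborel) = - (\<integral>x. ((G x - \<Gamma> x) \<bullet> b) * (\<beta> (W x) * \<xi> x) \<partial>lborel)"
        unfolding im using LIMSEQ_unique tendsto_minus by blast
      \<comment> \<open>The gradient of a compactly supported function has integral zero. This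
        survives the limit, and \<open>m\<close> is 1 wherever \<open>H\<close> is nonzero, so the
        left side of \<open>eq\<close> vanishes.\<close>
      have "(\<lambda>j. \<integral>x. b \<bullet> h j x \<partial>lborel) \<longlonglongrightarrow> (\<integral>x. b \<bullet> H x \<partial>lborel)"
        unfolding h_def H_def
        by (rule lim_test_grad(1)[OF \<xi>\<Omega>]) (use integrable_indicator_compact[of _ "(norm b)\<^sup>2"] in \<open>auto simp: mult.commute\<close>)
      moreover have "(\<integral>x. b \<bullet> h j x \<partial>lborel) = 0" for j
        using integral_gradient_C1c[OF test[of j]] by simp
      ultimately have "(\<integral>x. b \<bullet> H x \<partial>lborel) = 0" by (simp add: LIMSEQ_const_iff)
      moreover have "(\<integral>x. (m x *\<^sub>R b) \<bullet> H x \<partial>lborel) = (\<integral>x. b \<bullet> H x \<partial>lborel)"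
      proof (rule Bochner_Integration.integral_cong[OF refl])
        fix x
        show "(m x *\<^sub>R b) \<bullet> H x = b \<bullet> H x"
        proof (cases "x \<in> \<Omega> \<inter> B \<and> W x \<noteq> 0")
          case True
          then have "m x = 1" using W_eq[of x] by (auto simp: m_def max_def split: if_splits)
          then show ?thesis by simp
        next
          case False
          then have "H x = 0" using C1c_test_outside[OF \<xi>, of x] by (auto simp: H_def)
          then show ?thesis by simp
        qed
      qed
      ultimately have "(\<integral>x. ((G x - \<Gamma> x) \<bullet> b) * (\<beta> (W x) * \<xi> x) \<partial>lborel) = 0" using eq by simp
      then show ?thesis by (simp add: mult_ac)
    qed
  qed (use open_\<Omega> open_B in auto)
  then have "AE x in lborel. \<forall>b\<in>Basis. x \<in> \<Omega> \<inter> B \<longrightarrow> \<beta> (W x) * ((G x - \<Gamma> x) \<bullet> b) = 0"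
    by (subst AE_ball_countable) (auto simp: countable_finite)
  then show ?thesis
  proof eventually_elim
    case (elim x)
    show ?case
    proof (intro impI, rule euclidean_eqI)
      fix b :: 'a assume *: "x \<in> \<Omega> \<inter> B" "W x \<noteq> 0" "b \<in> Basis"
      then have "\<beta> (W x) \<noteq> 0" using \<beta>_pos[of "W x"] by simp
      moreover have "\<beta> (W x) * ((G x - \<Gamma> x) \<bullet> b) = 0" using elim *(1,3) by blast
      ultimately show "G x \<bullet> b = \<Gamma> x \<bullet> b" by (simp add: inner_diff_left)
    qed
  qed
qed

section \<open>The differential inequality for \<open>\<Lambda> (W x)\<close> across the
  boundary\<close>

lemma measurable_\<Lambda>_W: "(\<lambda>x. \<Lambda> (W x)) \<in> borel_measurable borel"
  by measurable

lemma integrable_\<Lambda>_W: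
  assumes "B \<subseteq> K" "compact K"
  shows "integrable lborel (\<lambda>x. indicator B x * \<Lambda> (W x))"
proof (rule integrable_lborel_bound)
  have [measurable]: "K \<in> sets borel" "B \<in> sets borel" using assms open_B by (auto simp: borel_compact)
  have "integrable lborel (\<lambda>x. indicator K x *\<^sub>R W x)"
    by (rule integrable_sq_imp[OF _ assms(2)]) (auto intro!: integrable_lborel_bound[OF W_L2] simp: indicator_def)
  then show "integrable lborel (\<lambda>x. 3 * \<bar>indicator K x * W x\<bar>)" by simp
  show "AE x in lborel. norm (indicator B x * \<Lambda> (W x)) \<le> 3 * \<bar>indicator K x * W x\<bar>"
    using abs_\<Lambda>_le assms(1) by (intro AE_I2) (auto simp: indicator_def)
  show "(\<lambda>x. indicator B x * \<Lambda> (W x)) \<in> borel_measurable borel" by measurable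
qed

text \<open>The weak form of \<open>\<Delta> (\<Lambda> W) \<ge> -1\<close>, as the gradient of
  \<open>\<Lambda> (W x)\<close> is \<open>(\<beta> (W x))\<^sup>2 *\<^sub>R \<Gamma> x\<close>.
  Here \<open>\<psi>\<close> may cross the boundary of \<open>\<Omega>\<close>, so the equation is
  tested with \<open>\<beta> (\<phi> j x) * (\<beta> (\<phi> k x) * \<psi> x)\<close>; each of the
  two limits discards one nonnegative term.\<close>

lemma energy_le:
  assumes \<psi>: "C1c_test B \<psi> \<psi>'" and \<psi>0: "\<And>x. 0 \<le> \<psi> x"
  shows "integrable lborel (\<lambda>x. (\<beta> (W x))\<^sup>2 * (\<Gamma> x \<bullet> \<psi>' x))"
    "(\<integral>x. (\<beta> (W x))\<^sup>2 * (\<Gamma> x \<bullet> \<psi>' x) \<partial>lborel) \<le> (\<integral>x. \<psi> x \<partial>lborel)"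
proof -
  note C1\<psi> = C1c_test_C1_grad[OF \<psi>]
  have [measurable]: "\<psi> \<in> borel_measurable borel" "\<psi>' \<in> borel_measurable borel" using C1_gradD[OF C1\<psi>] by auto
  obtain K where K: "compact K" "K \<subseteq> B" "\<And>x. x \<notin> K \<Longrightarrow> \<psi> x = 0" "\<And>x. x \<notin> K \<Longrightarrow> \<psi>' x = 0"
    using C1c_test_supportE[OF \<psi>] by metis
  have i\<psi>: "integrable lborel \<psi>" by (rule integrable_continuous_compact_support[OF C1_gradD(3)[OF C1\<psi>] K(1,3)])
  \<comment> \<open>What remains of \<open>G\<close> after the limit in j: on
    \<open>\<Omega> \<inter> B\<close> it agrees almost everywhere with
    \<open>\<beta> (W x) *\<^sub>R G x\<close>, but it is square integrable over the whole
    space.\<close>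
  define F where "F x = \<beta> (W x) *\<^sub>R \<Gamma> x" for x
  have [measurable]: "F \<in> borel_measurable borel" by (simp add: F_def[abs_def])
  have F_L2: "integrable lborel (\<lambda>x. indicator K x * (norm (F x))\<^sup>2)" if "compact K" for K
  proof (rule integrable_lborel_bound[OF \<Gamma>_L2])
    have [measurable]: "K \<in> sets borel" using that by (auto simp: borel_compact)
    show "(\<lambda>x. indicator K x * (norm (F x))\<^sup>2) \<in> borel_measurable borel" by measurable
    have "(\<beta> t)\<^sup>2 \<le> 1" for t using \<beta>_bounds(1,2)[of t] by (simp add: power_le_one)
    then show "AE x in lborel. norm (indicator K x * (norm (F x))\<^sup>2) \<le> (norm (\<Gamma> x))\<^sup>2"
      by (intro AE_I2) (auto simp: F_def indicator_def power_mult_distrib intro!: mult_left_le_one_le)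
  qed
  define \<xi>' where "\<xi>' k x = \<beta> (\<phi> k x) *\<^sub>R \<psi>' x + \<psi> x *\<^sub>R (\<beta>' (\<phi> k x) *\<^sub>R g k x)" for k x
  have step: "(\<integral>x. F x \<bullet> \<xi>' k x \<partial>lborel) \<le> (\<integral>x. \<psi> x \<partial>lborel)" for k
  proof -
    define \<xi> where "\<xi> x = \<beta> (\<phi> k x) * \<psi> x" for x
    have \<xi>B: "C1c_test (\<Omega> \<inter> B) \<xi> (\<xi>' k)" unfolding \<xi>_def[abs_def] \<xi>'_def[abs_def] by (rule C1c_test_\<beta>\<phi>_mult[OF \<psi>])
    have \<xi>: "C1c_test \<Omega> \<xi> (\<xi>' k)" using C1c_test_mono[OF \<xi>B] by blast
    have \<xi>0: "0 \<le> \<xi> x" "\<xi> x \<le> \<psi> x" for x using \<beta>_bounds(1,2) \<psi>0 by (auto simp: \<xi>_def intro!: mult_left_le_one_le)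
    have lim1: "(\<lambda>j. \<integral>x. G x \<bullet> (\<beta> (\<phi> j x) *\<^sub>R \<xi>' k x + \<xi> x *\<^sub>R (\<beta>' (\<phi> j x) *\<^sub>R g j x)) \<partial>lborel)
      \<longlonglongrightarrow> (\<integral>x. G x \<bullet> (\<beta> (W x) *\<^sub>R \<xi>' k x + \<xi> x *\<^sub>R (\<beta>' (W x) *\<^sub>R \<Gamma> x)) \<partial>lborel)"
      by (rule lim_test_grad(1)[OF \<xi> _ G_L2]) auto
    have i1: "integrable lborel (\<lambda>x. G x \<bullet> (\<beta> (W x) *\<^sub>R \<xi>' k x + \<xi> x *\<^sub>R (\<beta>' (W x) *\<^sub>R \<Gamma> x)))"
      by (rule lim_test_grad(2)[OF \<xi> _ G_L2]) auto
    have lim2: "(\<lambda>j. \<integral>x. f x * (\<beta> (\<phi> j x) * \<xi> x) \<partial>lborel) \<longlonglongrightarrow> (\<integral>x. f x * (\<beta> (W x) * \<xi> x) \<partial>lborel)"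
      by (rule lim_test(1)[OF \<xi> _ f_L1]) auto
    have i2: "integrable lborel (\<lambda>x. f x * (\<beta> (W x) * \<xi> x))"
      by (rule lim_test(2)[OF \<xi> _ f_L1]) auto
    have eqj: "(\<integral>x. G x \<bullet> (\<beta> (\<phi> j x) *\<^sub>R \<xi>' k x + \<xi> x *\<^sub>R (\<beta>' (\<phi> j x) *\<^sub>R g j x)) \<partial>lborel) = (\<integral>x. f x * (\<beta> (\<phi> j x) * \<xi> x) \<partial>lborel)" for j
      by (rule u_eq) (use C1c_test_\<beta>\<phi>_mult[OF \<xi>, of j] in simp)
    \<comment> \<open>Where \<open>W\<close> is nonzero, \<open>G\<close> equals
      \<open>\<Gamma>\<close>, so the term with \<open>\<beta>'\<close> is a nonnegative multiple of
      \<open>\<Gamma> x \<bullet> \<Gamma> x\<close> and is dropped; elsewhere both integrands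
      vanish.\<close>
    have "(\<integral>x. F x \<bullet> \<xi>' k x \<partial>lborel) \<le> (\<integral>x. G x \<bullet> (\<beta> (W x) *\<^sub>R \<xi>' k x + \<xi> x *\<^sub>R (\<beta>' (W x) *\<^sub>R \<Gamma> x)) \<partial>lborel)"
    proof (rule integral_mono_AE)
      show "integrable lborel (\<lambda>x. F x \<bullet> \<xi>' k x)" unfolding \<xi>'_def
        by (rule lim_test_grad(3)[OF \<psi> _ F_L2]) auto
      show "AE x in lborel. F x \<bullet> \<xi>' k x \<le> G x \<bullet> (\<beta> (W x) *\<^sub>R \<xi>' k x + \<xi> x *\<^sub>R (\<beta>' (W x) *\<^sub>R \<Gamma> x))"
        using gradient_eq
      proof eventually_elim
        case (elim x)
        show ?case
        proof (cases "x \<in> \<Omega> \<inter> B \<and> W x \<noteq> 0")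
          case True
          then have "G x = \<Gamma> x" using elim by blast
          moreover have "0 \<le> \<xi> x * \<beta>' (W x) * (\<Gamma> x \<bullet> \<Gamma> x)" using \<xi>0 \<beta>'_nonneg[OF W_nonneg] by simp
          ultimately show ?thesis by (simp add: F_def inner_add_right mult.assoc)
        next
          case False
          then show ?thesis using C1c_test_outside[OF \<xi>B, of x] by (auto simp: F_def)
        qed
      qed
    qed (rule i1)
    also have "\<dots> = (\<integral>x. f x * (\<beta> (W x) * \<xi> x) \<partial>lborel)"
      using lim1 lim2 unfolding eqj by (rule LIMSEQ_unique)
    \<comment> \<open>The factor \<open>\<beta> (W x)\<close> vanishes unless
      \<open>1 < u x\<close>, so the range where \<open>f\<close> may be large never
      contributes.\<close>
    also have "\<dots> \<le> (\<integral>x. \<psi> x \<partial>lborel)"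
    proof (rule integral_mono[OF i2 i\<psi>])
      fix x
      show "f x * (\<beta> (W x) * \<xi> x) \<le> \<psi> x"
      proof (cases "x \<in> \<Omega> \<inter> B \<and> W x \<noteq> 0")
        case True
        then have "1 < u x" using W_eq[of x] by (auto simp: max_def split: if_splits)
        then have "f x \<le> 1" using f_le True by auto
        moreover have b: "0 \<le> \<beta> (W x) * \<xi> x" "\<beta> (W x) * \<xi> x \<le> \<psi> x"
          using \<beta>_bounds(1,2) \<xi>0[of x] mult_left_le_one_le[of "\<xi> x" "\<beta> (W x)"] by auto
        ultimately have "f x * (\<beta> (W x) * \<xi> x) \<le> 1 * (\<beta> (W x) * \<xi> x)" by (intro mult_right_mono)
        then show ?thesis using b by simp
      next
        case False
        then show ?thesis using C1c_test_outside[OF \<xi>B, of x] \<psi>0[of x] by auto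
      qed
    qed
    finally show ?thesis .
  qed
  have lim: "(\<lambda>k. \<integral>x. F x \<bullet> \<xi>' k x \<partial>lborel) \<longlonglongrightarrow> (\<integral>x. F x \<bullet> (\<beta> (W x) *\<^sub>R \<psi>' x + \<psi> x *\<^sub>R (\<beta>' (W x) *\<^sub>R \<Gamma> x)) \<partial>lborel)"
    unfolding \<xi>'_def by (rule lim_test_grad(1)[OF \<psi> _ F_L2]) auto
  have i: "integrable lborel (\<lambda>x. F x \<bullet> (\<beta> (W x) *\<^sub>R \<psi>' x + \<psi> x *\<^sub>R (\<beta>' (W x) *\<^sub>R \<Gamma> x)))"
    by (rule lim_test_grad(2)[OF \<psi> _ F_L2]) auto
  obtain C where C: "C > 0" "\<And>x. norm (\<psi>' x) \<le> C * indicator K x"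
    using continuous_compact_support_bounded[OF C1_gradD(2)[OF C1\<psi>] K(1,4)] by blast
  have iF: "integrable lborel (\<lambda>x. C * norm (indicator K x *\<^sub>R F x))"
    using integrable_sq_imp[OF F_L2 K(1)] K(1) by (intro integrable_mult_right integrable_norm) auto
  show i': "integrable lborel (\<lambda>x. (\<beta> (W x))\<^sup>2 * (\<Gamma> x \<bullet> \<psi>' x))"
  proof (rule integrable_lborel_bound[OF iF])
    have "\<bar>(\<beta> (W x))\<^sup>2 * (\<Gamma> x \<bullet> \<psi>' x)\<bar> \<le> C * norm (indicator K x *\<^sub>R F x)" for x
    proof -
      have "\<bar>(\<beta> (W x))\<^sup>2 * (\<Gamma> x \<bullet> \<psi>' x)\<bar> = \<bar>\<beta> (W x)\<bar> * \<bar>F x \<bullet> \<psi>' x\<bar>"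
        by (simp add: F_def power2_eq_square abs_mult)
      also have "\<dots> \<le> 1 * (norm (F x) * (C * indicator K x))"
        using \<beta>_bounds(3) C(2)[of x]
        by (intro mult_mono order_trans[OF Cauchy_Schwarz_ineq2] mult_left_mono) auto
      finally show ?thesis by (simp add: mult_ac)
    qed
    then show "AE x in lborel. norm ((\<beta> (W x))\<^sup>2 * (\<Gamma> x \<bullet> \<psi>' x)) \<le> C * norm (indicator K x *\<^sub>R F x)" by auto
  qed simp
  \<comment> \<open>Only in the limit does the second term with \<open>\<beta>'\<close> have a sign:
    for fixed k it contains the inner product of \<open>\<Gamma> x\<close> with
    \<open>g k x\<close>.\<close>
  have "(\<integral>x. (\<beta> (W x))\<^sup>2 * (\<Gamma> x \<bullet> \<psi>' x) \<partial>lborel) \<le> (\<integral>x. F x \<bullet> (\<beta> (W x) *\<^sub>R \<psi>' x + \<psi> x *\<^sub>R (\<beta>' (W x) *\<^sub>R \<Gamma> x)) \<partial>lborel)"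
  proof (rule integral_mono[OF i' i])
    fix x
    have "0 \<le> \<beta> (W x) * (\<psi> x * (\<beta>' (W x) * (\<Gamma> x \<bullet> \<Gamma> x)))"
      using \<beta>_bounds(1) \<psi>0 \<beta>'_nonneg[OF W_nonneg] by simp
    then show "(\<beta> (W x))\<^sup>2 * (\<Gamma> x \<bullet> \<psi>' x) \<le> F x \<bullet> (\<beta> (W x) *\<^sub>R \<psi>' x + \<psi> x *\<^sub>R (\<beta>' (W x) *\<^sub>R \<Gamma> x))"
      by (simp add: F_def inner_add_right power2_eq_square mult_ac distrib_left)
  qed
  also have "\<dots> \<le> (\<integral>x. \<psi> x \<partial>lborel)" using lim step by (auto intro: LIMSEQ_le_const2)
  finally show "(\<integral>x. (\<beta> (W x))\<^sup>2 * (\<Gamma> x \<bullet> \<psi>' x) \<partial>lborel) \<le> (\<integral>x. \<psi> x \<partial>lborel)" .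
qed

text \<open>The chain rule for \<open>\<Lambda> (W x)\<close>, valid across the boundary: here the
  zero boundary values enter, as \<open>\<eta>\<close> may be nonzero on the boundary of
  \<open>\<Omega>\<close>. For each k the function \<open>\<Lambda> (\<phi> k x) * \<eta> x\<close>
  is C1 with compact support, so its gradient integrates to zero, and the identity passes to the
  limit.\<close>

lemma integral_by_parts_component:
  assumes q: "C1c_test V \<eta> q" and b: "b \<in> Basis"
  shows "integrable lborel (\<lambda>x. \<Lambda> (W x) * (q x \<bullet> b))" "integrable lborel (\<lambda>x. (\<beta> (W x))\<^sup>2 * (\<eta> x * (\<Gamma> x \<bullet> b)))"
    "(\<integral>x. \<Lambda> (W x) * (q x \<bullet> b) \<partial>lborel) = - (\<integral>x. (\<beta> (W x))\<^sup>2 * (\<eta> x * (\<Gamma> x \<bullet> b)) \<partial>lborel)"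
proof -
  note C1 = C1c_test_C1_grad[OF q]
  have [measurable]: "\<eta> \<in> borel_measurable borel" "q \<in> borel_measurable borel" using C1_gradD[OF C1] by auto
  obtain K where K: "compact K" "\<And>x. x \<notin> K \<Longrightarrow> \<eta> x = 0" "\<And>x. x \<notin> K \<Longrightarrow> q x = 0"
    using C1c_test_supportE[OF q] by metis
  have [measurable]: "K \<in> sets borel" using K by (simp add: borel_compact)
  obtain C1 where C1: "C1 > 0" "\<And>x. norm (\<eta> x) \<le> C1 * indicator K x"
    using continuous_compact_support_bounded[OF C1_gradD(3)[OF C1] K(1,2)] by blast
  obtain C2 where C2: "C2 > 0" "\<And>x. norm (q x) \<le> C2 * indicator K x"
    using continuous_compact_support_bounded[OF C1_gradD(2)[OF C1c_test_C1_grad[OF q]] K(1,3)] by blast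
  have D: "integrable lborel (\<lambda>x. indicator K x *\<^sub>R D x)"
    by (rule integrable_sq_imp[OF _ K(1)]) (auto intro!: integrable_lborel_bound[OF D_L2] simp: indicator_def)
  define w1 where "w1 x = (3 * C2) * \<bar>indicator K x * D x\<bar>" for x
  define w2 where "w2 x = C1 * \<bar>indicator K x * D x\<bar>" for x
  have w1: "integrable lborel w1" and w2: "integrable lborel w2"
    unfolding w1_def w2_def using D by (intro integrable_mult_right integrable_abs, simp)+
  have b1: "\<bar>\<Lambda> t * (q x \<bullet> b)\<bar> \<le> w1 x" if "\<bar>t\<bar> \<le> D x" for t x
  proof -
    have "\<bar>q x \<bullet> b\<bar> \<le> C2 * indicator K x" using Basis_le_norm[OF b, of "q x"] C2(2)[of x] by linarith
    moreover have "\<bar>\<Lambda> t\<bar> \<le> 3 * D x" using abs_\<Lambda>_le[of t] that by linarith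
    ultimately have "\<bar>\<Lambda> t\<bar> * \<bar>q x \<bullet> b\<bar> \<le> (3 * D x) * (C2 * indicator K x)"
      by (intro mult_mono) (use that in auto)
    moreover have "0 \<le> D x" using that by linarith
    ultimately show ?thesis by (simp add: w1_def abs_mult mult_ac)
  qed
  have b2: "\<bar>(\<beta> t)\<^sup>2 * (\<eta> x * (v \<bullet> b))\<bar> \<le> w2 x" if "norm v \<le> D x" for t x v
  proof -
    have "\<bar>v \<bullet> b\<bar> \<le> D x" using Basis_le_norm[OF b, of v] that by linarith
    then have "\<bar>\<eta> x\<bar> * \<bar>v \<bullet> b\<bar> \<le> (C1 * indicator K x) * D x"
      using C1(2)[of x] C1(1) by (intro mult_mono) auto
    moreover have "(\<beta> t)\<^sup>2 \<le> 1" using \<beta>_bounds(1,2)[of t] by (simp add: power_le_one)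
    ultimately have "(\<beta> t)\<^sup>2 * (\<bar>\<eta> x\<bar> * \<bar>v \<bullet> b\<bar>) \<le> 1 * ((C1 * indicator K x) * D x)" by (intro mult_mono[of "(\<beta> t)\<^sup>2"]) auto
    moreover have "0 \<le> D x" using that norm_ge_zero order_trans by blast
    ultimately show ?thesis by (simp add: w2_def abs_mult mult_ac)
  qed
  have B1: "AE x in lborel. norm (\<Lambda> (\<phi> k x) * (q x \<bullet> b)) \<le> w1 x" "AE x in lborel. norm ((\<beta> (\<phi> k x))\<^sup>2 * (\<eta> x * (g k x \<bullet> b))) \<le> w2 x" for k
    using approx by (eventually_elim, use b1 b2 in auto)+
  have B2: "AE x in lborel. norm (\<Lambda> (W x) * (q x \<bullet> b)) \<le> w1 x" "AE x in lborel. norm ((\<beta> (W x))\<^sup>2 * (\<eta> x * (\<Gamma> x \<bullet> b))) \<le> w2 x"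
    using majorant by (eventually_elim, use b1 b2 in auto)+
  show "integrable lborel (\<lambda>x. \<Lambda> (W x) * (q x \<bullet> b))" by (rule integrable_lborel_bound[OF w1 _ B2(1)]) simp
  show "integrable lborel (\<lambda>x. (\<beta> (W x))\<^sup>2 * (\<eta> x * (\<Gamma> x \<bullet> b)))" by (rule integrable_lborel_bound[OF w2 _ B2(2)]) simp
  have ik: "integrable lborel (\<lambda>x. \<Lambda> (\<phi> k x) * (q x \<bullet> b))" "integrable lborel (\<lambda>x. (\<beta> (\<phi> k x))\<^sup>2 * (\<eta> x * (g k x \<bullet> b)))" for k
    by (rule integrable_lborel_bound[OF w1 _ B1(1)], simp) (rule integrable_lborel_bound[OF w2 _ B1(2)], simp)
  have L1: "(\<lambda>k. \<integral>x. \<Lambda> (\<phi> k x) * (q x \<bullet> b) \<partial>lborel) \<longlonglongrightarrow> (\<integral>x. \<Lambda> (W x) * (q x \<bullet> b) \<partial>lborel)"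
  proof (rule integral_dominated_convergence[OF _ _ w1 _ B1(1)])
    show "AE x in lborel. (\<lambda>k. \<Lambda> (\<phi> k x) * (q x \<bullet> b)) \<longlonglongrightarrow> \<Lambda> (W x) * (q x \<bullet> b)"
      using approx by eventually_elim (intro tendsto_intros tendsto_\<beta>, auto)
  qed auto
  have L2: "(\<lambda>k. \<integral>x. (\<beta> (\<phi> k x))\<^sup>2 * (\<eta> x * (g k x \<bullet> b)) \<partial>lborel) \<longlonglongrightarrow> (\<integral>x. (\<beta> (W x))\<^sup>2 * (\<eta> x * (\<Gamma> x \<bullet> b)) \<partial>lborel)"
  proof (rule integral_dominated_convergence[OF _ _ w2 _ B1(2)])
    show "AE x in lborel. (\<lambda>k. (\<beta> (\<phi> k x))\<^sup>2 * (\<eta> x * (g k x \<bullet> b))) \<longlonglongrightarrow> (\<beta> (W x))\<^sup>2 * (\<eta> x * (\<Gamma> x \<bullet> b))"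
      using approx by eventually_elim (intro tendsto_intros tendsto_\<beta>, auto)
  qed auto
  have "(\<integral>x. \<Lambda> (\<phi> k x) * (q x \<bullet> b) \<partial>lborel) = - (\<integral>x. (\<beta> (\<phi> k x))\<^sup>2 * (\<eta> x * (g k x \<bullet> b)) \<partial>lborel)" for k
  proof -
    have "C1_grad (\<lambda>x. \<Lambda> (\<phi> k x)) (\<lambda>x. (\<beta> (\<phi> k x))\<^sup>2 *\<^sub>R g k x)"
      by (rule C1_grad_compose[OF C1c_test_C1_grad[OF test_\<phi>] DERIV_\<Lambda>]) (intro continuous_intros continuous_on_\<beta>)
    from integral_gradient_C1c[OF C1c_test_mult_C1[OF this q]]
    have "(\<integral>x. (\<Lambda> (\<phi> k x) *\<^sub>R q x + \<eta> x *\<^sub>R ((\<beta> (\<phi> k x))\<^sup>2 *\<^sub>R g k x)) \<bullet> b \<partial>lborel) = 0"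
      by (subst integral_inner_left) auto
    moreover have "(\<integral>x. (\<Lambda> (\<phi> k x) *\<^sub>R q x + \<eta> x *\<^sub>R ((\<beta> (\<phi> k x))\<^sup>2 *\<^sub>R g k x)) \<bullet> b \<partial>lborel)
       = (\<integral>x. \<Lambda> (\<phi> k x) * (q x \<bullet> b) + (\<beta> (\<phi> k x))\<^sup>2 * (\<eta> x * (g k x \<bullet> b)) \<partial>lborel)"
      by (simp add: inner_add_left mult_ac)
    ultimately show ?thesis using ik[of k] by simp
  qed
  then have "(\<lambda>k. \<integral>x. \<Lambda> (\<phi> k x) * (q x \<bullet> b) \<partial>lborel) \<longlonglongrightarrow> - (\<integral>x. (\<beta> (W x))\<^sup>2 * (\<eta> x * (\<Gamma> x \<bullet> b)) \<partial>lborel)"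
    using tendsto_minus[OF L2] by simp
  then show "(\<integral>x. \<Lambda> (W x) * (q x \<bullet> b) \<partial>lborel) = - (\<integral>x. (\<beta> (W x))\<^sup>2 * (\<eta> x * (\<Gamma> x \<bullet> b)) \<partial>lborel)"
    using L1 LIMSEQ_unique by blast
qed

text \<open>Second derivatives are encoded through the components of the gradient \<open>p\<close>,
  each again C1 with gradient \<open>q b\<close>; the sum over the basis is the Laplacian of
  \<open>\<psi>\<close>. One integration by parts per component leads back to
  \<open>energy_le\<close>.\<close>

lemma laplacian_ge:
  assumes \<psi>: "C1c_test B \<psi> p" and \<psi>0: "\<And>x. 0 \<le> \<psi> x" and q: "\<And>b. b \<in> Basis \<Longrightarrow> C1c_test B (\<lambda>x. p x \<bullet> b) (q b)"
  shows "- (\<integral>x. \<psi> x \<partial>lborel) \<le> (\<integral>x. \<Lambda> (W x) * (\<Sum>b\<in>Basis. q b x \<bullet> b) \<partial>lborel)"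
proof -
  have "(\<integral>x. \<Lambda> (W x) * (\<Sum>b\<in>Basis. q b x \<bullet> b) \<partial>lborel) = (\<Sum>b\<in>Basis. \<integral>x. \<Lambda> (W x) * (q b x \<bullet> b) \<partial>lborel)"
    unfolding sum_distrib_left using integral_by_parts_component(1)[OF q] by (subst Bochner_Integration.integral_sum) auto
  also have "\<dots> = - (\<Sum>b\<in>Basis. \<integral>x. (\<beta> (W x))\<^sup>2 * ((p x \<bullet> b) * (\<Gamma> x \<bullet> b)) \<partial>lborel)"
    using integral_by_parts_component(3)[OF q] by (simp add: sum_negf)
  also have "\<dots> = - (\<integral>x. (\<beta> (W x))\<^sup>2 * (\<Gamma> x \<bullet> p x) \<partial>lborel)"
  proof -
    have "(\<beta> (W x))\<^sup>2 * (\<Gamma> x \<bullet> p x) = (\<Sum>b\<in>Basis. (\<beta> (W x))\<^sup>2 * ((p x \<bullet> b) * (\<Gamma> x \<bullet> b)))" for x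
      unfolding sum_distrib_left[symmetric] inner_commute[of "\<Gamma> x" "p x"] by (subst euclidean_inner) (rule refl)
    then show ?thesis
      using integral_by_parts_component(2)[OF q] by (simp add: Bochner_Integration.integral_sum)
  qed
  finally show ?thesis using energy_le(2)[OF \<psi> \<psi>0] by simp
qed

end

section \<open>Local boundedness of almost subharmonic functions\<close>

lemma integrable_lborel_pair_bound:
  fixes f :: "'a::euclidean_space \<times> 'b::euclidean_space \<Rightarrow> real"
  assumes f: "f \<in> borel_measurable (lborel \<Otimes>\<^sub>M lborel)"
    and a: "integrable lborel (a :: 'a \<Rightarrow> real)" and b: "integrable lborel (b :: 'b \<Rightarrow> real)"
    and bound: "\<And>x y. \<bar>f (x, y)\<bar> \<le> a x * b y"
  shows "integrable (lborel \<Otimes>\<^sub>M lborel) f"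
proof (rule Bochner_Integration.integrable_bound)
  have [measurable]: "a \<in> borel_measurable borel" "b \<in> borel_measurable borel" using a b by auto
  show "integrable (lborel \<Otimes>\<^sub>M lborel) (\<lambda>(x, y). a x * b y)"
    by (rule lborel_pair.Fubini_integrable) (use a b in \<open>auto simp: abs_mult\<close>)
  show "AE x in lborel \<Otimes>\<^sub>M lborel. norm (f x) \<le> norm (case x of (x, y) \<Rightarrow> a x * b y)"
    using bound by (intro AE_I2) (auto split: prod.splits intro: order_trans[OF _ abs_ge_self])
qed (rule f)

section \<open>Radial kernels with scale-independent mass\<close>

definition bump :: "real \<Rightarrow> 'a::euclidean_space \<Rightarrow> real" where
  "bump r z = max 0 (r\<^sup>2 - (norm z)\<^sup>2)"

text \<open>The mass-preserving dilation of the profile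
  \<open>(max 0 (1 - (norm z)\<^sup>2))\<^sup>2\<close>: the numerator is \<open>r ^ 4\<close> times
  the profile at \<open>z / r\<close>, and the remaining powers of \<open>r\<close> compensate the
  volume.\<close>

definition kern :: "real \<Rightarrow> 'a::euclidean_space \<Rightarrow> real" where
  "kern r z = (bump r z)\<^sup>2 / r ^ (DIM('a) + 4)"

text \<open>The derivative of \<open>kern\<close> in \<open>r\<close>, as a polynomial in the bump
  so that it can be matched with a Laplacian.\<close>

definition dkern :: "real \<Rightarrow> 'a::euclidean_space \<Rightarrow> real" where
  "dkern r z = (4 * r\<^sup>2 * bump r z - real (DIM('a) + 4) * (bump r z)\<^sup>2) / r ^ (DIM('a) + 5)"

lemma bump_bounds: "0 \<le> bump r z" "bump r z \<le> r\<^sup>2"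
  by (auto simp: bump_def)

lemma bump_eq_0: "0 \<le> r \<Longrightarrow> r \<le> norm z \<Longrightarrow> bump r z = 0"
  by (simp add: bump_def power_mono)

lemma measurable_bump [measurable]:
  "(\<lambda>p. bump (fst p) (snd p :: 'a::euclidean_space)) \<in> borel_measurable (borel \<Otimes>\<^sub>M borel)"
  unfolding bump_def by measurable

lemma measurable_kern [measurable]:
  "(\<lambda>p. kern (fst p) (snd p :: 'a::euclidean_space)) \<in> borel_measurable (borel \<Otimes>\<^sub>M borel)"
  "(\<lambda>p. dkern (fst p) (snd p :: 'a::euclidean_space)) \<in> borel_measurable (borel \<Otimes>\<^sub>M borel)"
  unfolding kern_def dkern_def bump_def by measurable

lemma measurable_kern' [measurable (raw)]:
  assumes "f \<in> borel_measurable M" "g \<in> borel_measurable M"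
  shows "(\<lambda>x. kern (f x) (g x :: 'a::euclidean_space)) \<in> borel_measurable M"
    "(\<lambda>x. dkern (f x) (g x :: 'a::euclidean_space)) \<in> borel_measurable M"
    "(\<lambda>x. bump (f x) (g x :: 'a::euclidean_space)) \<in> borel_measurable M"
  using measurable_compose[OF measurable_Pair[OF assms] measurable_kern(1)]
    measurable_compose[OF measurable_Pair[OF assms] measurable_kern(2)]
    measurable_compose[OF measurable_Pair[OF assms] measurable_bump] by simp_all

lemma DERIV_kern:
  fixes z :: "'a::euclidean_space"
  assumes "r > 0"
  shows "((\<lambda>r. kern r z) has_real_derivative dkern r z) (at r)"
proof -
  let ?n = "DIM('a) + 4"
  have 1: "((\<lambda>r. (bump r z)\<^sup>2) has_real_derivative (2 * bump r z) * (2 * r)) (at r)"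
  proof -
    have "((\<lambda>r. r\<^sup>2 - (norm z)\<^sup>2) has_real_derivative 2 * r) (at r)"
      by (auto intro!: derivative_eq_intros)
    from DERIV_chain2[OF DERIV_pos_part_power[of 0] this] show ?thesis
      by (simp add: bump_def[abs_def] power2_eq_square)
  qed
  have "((\<lambda>r. kern r z) has_real_derivative
      ((2 * bump r z) * (2 * r) * r ^ ?n - (bump r z)\<^sup>2 * (real ?n * r ^ (?n - 1))) / (r ^ ?n * r ^ ?n)) (at r)"
    unfolding kern_def[abs_def]
    by (rule DERIV_divide[OF 1 DERIV_cong[OF DERIV_pow]]) (use assms in auto)
  moreover have "((2 * p) * (2 * r) * r ^ ?n - p\<^sup>2 * (c * r ^ (?n - 1))) / (r ^ ?n * r ^ ?n)
     = (4 * r\<^sup>2 * p - c * p\<^sup>2) / r ^ (DIM('a) + 5)" for p c :: real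
    using assms by (simp add: field_simps power2_eq_square power_add eval_nat_numeral)
  ultimately show ?thesis by (simp add: dkern_def)
qed

lemma continuous_dkern: "continuous_on {0<..} (\<lambda>r. dkern r z)"
  unfolding dkern_def bump_def by (intro continuous_intros) auto

lemma C1_grad_bump:
  "C1_grad (\<lambda>x. bump r (x - y) ^ (n + 2)) (\<lambda>x. (real (n+2) * bump r (x - y) ^ (n+1)) *\<^sub>R ((-2) *\<^sub>R (x - y)))"
  unfolding bump_def by (rule C1_grad_pos_part_power[OF C1_grad_norm_diff])

text \<open>\<open>dkern r\<close> is the Laplacian of \<open>bump r ^ 3 / (6 r ^ (DIM + 5))\<close>.\<close>

lemma dkern_laplacian:
  fixes y :: "'a::euclidean_space"
  assumes r: "0 < r" and sub: "cball y r \<subseteq> U"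
  obtains \<psi> p q where "C1c_test U \<psi> p" "\<And>x. 0 \<le> \<psi> x" "\<And>b. b \<in> Basis \<Longrightarrow> C1c_test U (\<lambda>x. p x \<bullet> b) (q b)"
    "\<And>x. (\<Sum>b\<in>Basis. q b x \<bullet> b) = dkern r (x - y)"
    "(\<integral>x. \<psi> x \<partial>lborel) \<le> r * measure lborel (ball (0::'a) 1)"
proof -
  define c where "c = 1 / r ^ (DIM('a) + 5)"
  have c: "c > 0" using r by (simp add: c_def)
  define \<psi> where "\<psi> x = c / 6 * bump r (x - y) ^ (1 + 2)" for x
  \<comment> \<open>This field is \<open>x - y\<close> times \<open>- kern r (x - y) / r\<close>,
    the flux of the dilation. The cube in \<open>\<psi>\<close> is what makes it C1.\<close>
  define p where "p x = (c / 6) *\<^sub>R ((real (1+2) * bump r (x - y) ^ (1+1)) *\<^sub>R ((-2) *\<^sub>R (x - y)))" for x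
  define q where "q b x = (- c) *\<^sub>R ((bump r (x - y) ^ (0 + 2)) *\<^sub>R b +
      ((x - y) \<bullet> b) *\<^sub>R ((real (0+2) * bump r (x - y) ^ (0+1)) *\<^sub>R ((-2) *\<^sub>R (x - y))))" for b x
  have out: "bump r (x - y) = 0" if "x \<notin> cball y r" for x
    using that r by (intro bump_eq_0) (auto simp: dist_norm norm_minus_commute)
  have 1: "C1_grad \<psi> p" unfolding \<psi>_def[abs_def] p_def[abs_def] by (intro C1_grad_cmult C1_grad_bump)
  have peq: "p x \<bullet> b = - c * (bump r (x - y) ^ (0 + 2) * ((x - y) \<bullet> b))" for x b
    by (simp add: p_def power2_eq_square)
  have 2: "C1_grad (\<lambda>x. p x \<bullet> b) (q b)" for b
    unfolding peq q_def[abs_def] by (intro C1_grad_cmult C1_grad_mult C1_grad_bump C1_grad_inner_const)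
  have t1: "C1c_test U \<psi> p" unfolding C1c_test_iff
    by (intro conjI 1 exI[of _ "cball y r"]) (use sub out in \<open>auto simp: \<psi>_def p_def simp del: mem_cball\<close>)
  have t2: "C1c_test U (\<lambda>x. p x \<bullet> b) (q b)" for b unfolding C1c_test_iff
    by (intro conjI 2 exI[of _ "cball y r"]) (use sub out in \<open>auto simp: q_def p_def simp del: mem_cball\<close>)
  have pos: "0 \<le> \<psi> x" for x using c bump_bounds(1)[of r "x - y"] by (simp add: \<psi>_def)
  have lap: "(\<Sum>b\<in>Basis. q b x \<bullet> b) = dkern r (x - y)" for x
  proof -
    define P where "P = bump r (x - y)"
    have "(\<Sum>b\<in>Basis. q b x \<bullet> b) = (\<Sum>b\<in>Basis. - c * (P\<^sup>2 - 4 * P * (((x - y) \<bullet> b) * ((x - y) \<bullet> b))))"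
    proof (rule sum.cong[OF refl])
      fix b :: 'a assume b: "b \<in> Basis"
      have "q b x \<bullet> b = - c * (P\<^sup>2 * (b \<bullet> b) + ((x - y) \<bullet> b) * (2 * P * ((-2) * ((x - y) \<bullet> b))))"
        unfolding q_def P_def by (simp add: inner_add_left power2_eq_square algebra_simps)
      then show "q b x \<bullet> b = - c * (P\<^sup>2 - 4 * P * (((x - y) \<bullet> b) * ((x - y) \<bullet> b)))"
        using b by (simp add: algebra_simps)
    qed
    also have "\<dots> = - c * (real DIM('a) * P\<^sup>2 - 4 * P * ((x - y) \<bullet> (x - y)))"
      unfolding euclidean_inner[of "x - y" "x - y"]
      by (simp only: sum_distrib_left[symmetric] sum_subtractf sum_constant)
    \<comment> \<open>On the support \<open>(x - y) \<bullet> (x - y)\<close> is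
      \<open>r\<^sup>2 - P\<close>, which raises the coefficient from \<open>DIM('a)\<close> to
      \<open>DIM('a) + 4\<close>.\<close>
    also have "\<dots> = c * (4 * r\<^sup>2 * P - real (DIM('a) + 4) * P\<^sup>2)"
    proof (cases "P = 0")
      case False
      then have "P = r\<^sup>2 - (x - y) \<bullet> (x - y)"
        by (auto simp: P_def bump_def power2_norm_eq_inner max_def split: if_splits)
      then have xy: "(x - y) \<bullet> (x - y) = r\<^sup>2 - P" by simp
      show ?thesis unfolding xy by (simp add: algebra_simps power2_eq_square)
    qed simp
    also have "\<dots> = dkern r (x - y)" by (simp add: dkern_def c_def P_def)
    finally show ?thesis .
  qed
  \<comment> \<open>Bounding the bump by \<open>r\<^sup>2\<close> gives height
    \<open>r ^ 6 * c\<close>; together with the volume of the ball, of order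
    \<open>r ^ DIM('a)\<close>, exactly one power of \<open>r\<close> is left.\<close>
  have "(\<integral>x. \<psi> x \<partial>lborel) \<le> (\<integral>x. r ^ 6 * c * indicator (cball y r) x \<partial>lborel)"
  proof (rule integral_mono)
    show "integrable lborel \<psi>"
      by (rule integrable_continuous_compact_support[OF C1_gradD(3)[OF 1], of "cball y r"])
         (use out in \<open>auto simp: \<psi>_def simp del: mem_cball\<close>)
    show "integrable lborel (\<lambda>x. r ^ 6 * c * indicator (cball y r) x)"
      by (rule integrable_indicator_compact) simp
    show "\<psi> x \<le> r ^ 6 * c * indicator (cball y r) x" for x
    proof (cases "x \<in> cball y r")
      case True
      have "bump r (x - y) ^ (1+2) \<le> (r\<^sup>2) ^ (1+2)" by (intro power_mono bump_bounds)
      then have "c / 6 * bump r (x - y) ^ (1+2) \<le> c / 6 * (r\<^sup>2) ^ (1+2)" using c by (intro mult_left_mono) auto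
      also have "\<dots> \<le> c * r ^ 6" using c r by (simp add: power_mult[symmetric])
      finally show ?thesis using True by (simp add: \<psi>_def mult.commute)
    qed (use out in \<open>simp add: \<psi>_def del: mem_cball\<close>)
  qed
  also have "\<dots> = r ^ 6 * c * measure lborel (cball y r)" by simp
  also have "measure lborel (cball y r) = r ^ DIM('a) * measure lborel (ball (0::'a) 1)"
    using r content_ball_conv_unit_ball[of r y] by (simp add: content_cball_conv_ball)
  also have "r ^ 6 * c * (r ^ DIM('a) * measure lborel (ball (0::'a) 1)) = r * measure lborel (ball (0::'a) 1)"
    using r by (simp add: c_def power_add eval_nat_numeral field_simps)
  finally have "(\<integral>x. \<psi> x \<partial>lborel) \<le> r * measure lborel (ball (0::'a) 1)" .
  with t1 pos t2 lap show ?thesis by (rule that)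
qed

lemma kern_nonneg: "0 \<le> r \<Longrightarrow> 0 \<le> kern r z"
  by (simp add: kern_def)

lemma kern_eq_0: "0 \<le> r \<Longrightarrow> r \<le> norm z \<Longrightarrow> kern r z = 0" "0 \<le> r \<Longrightarrow> r \<le> norm z \<Longrightarrow> dkern r z = 0"
  by (auto simp: kern_def dkern_def bump_eq_0)

lemma kern_le:
  fixes z :: "'a::euclidean_space"
  assumes "0 < r" shows "kern r z \<le> r ^ 4 / r ^ (DIM('a) + 4)"
proof -
  have "(bump r z)\<^sup>2 \<le> (r\<^sup>2)\<^sup>2" by (intro power_mono bump_bounds)
  then show ?thesis using assms by (auto simp: kern_def power_mult[symmetric] intro!: divide_right_mono)
qed

text \<open>This only justifies Fubini for fixed \<open>\<delta>\<close>, so blow-up as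
  \<open>\<delta>\<close> tends to 0 is harmless. The numerator is 4 plus
  \<open>DIM('a) + 4\<close>, one for each summand of \<open>dkern\<close>.\<close>

lemma abs_dkern_le:
  fixes z :: "'a::euclidean_space"
  assumes "0 < \<delta>" "\<delta> \<le> r" "r \<le> 1"
  shows "\<bar>dkern r z\<bar> \<le> (DIM('a) + 8) / \<delta> ^ (DIM('a) + 5)"
proof -
  have r2: "r\<^sup>2 \<le> 1" using assms by (simp add: power_le_one)
  then have b: "0 \<le> bump r z" "bump r z \<le> 1" using bump_bounds[of r z] by auto
  have b1: "\<bar>4 * r\<^sup>2 * bump r z\<bar> \<le> 4" using r2 b mult_le_one[OF r2 b] by (simp add: abs_mult)
  have b2: "\<bar>real (DIM('a) + 4) * (bump r z)\<^sup>2\<bar> \<le> real (DIM('a) + 4)"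
    using b power_le_one[OF b, of 2] mult_left_mono[of "(bump r z)\<^sup>2" 1 "real (DIM('a) + 4)"] by simp
  have "\<bar>4 * r\<^sup>2 * bump r z - real (DIM('a) + 4) * (bump r z)\<^sup>2\<bar> \<le> DIM('a) + 8"
    using b1 b2 abs_triangle_ineq4[of "4 * r\<^sup>2 * bump r z" "real (DIM('a) + 4) * (bump r z)\<^sup>2"] by linarith
  moreover have "\<delta> ^ (DIM('a) + 5) \<le> r ^ (DIM('a) + 5)" using assms by (intro power_mono) auto
  moreover have "0 < \<delta> ^ (DIM('a) + 5)" "0 < r ^ (DIM('a) + 5)" using assms by auto
  ultimately show ?thesis unfolding dkern_def abs_divide
    by (intro frac_le) auto
qed

lemma integral_translate:
  fixes f :: "'a::euclidean_space \<Rightarrow> real"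
  assumes [measurable]: "f \<in> borel_measurable borel"
  shows "(\<integral>x. f (x - y) \<partial>lborel) = (\<integral>x. f x \<partial>lborel)"
  by (subst (2) lborel_distr_plus[symmetric, of "- y"]) (simp add: integral_distr)

text \<open>On the ball of radius \<open>\<delta> / 2\<close> the bump is at least
  \<open>3 / 4 * \<delta>\<^sup>2\<close>, whence the factor 9/16 and the power of 2. The point is
  independence of \<open>\<delta>\<close>; the exact mass is never computed.\<close>

lemma kern_mass_ge:
  assumes "0 < \<delta>"
  shows "9 / 16 * measure lborel (ball (0::'a::euclidean_space) 1) / 2 ^ DIM('a) \<le> (\<integral>z. kern \<delta> (z::'a) \<partial>lborel)"
    "integrable lborel (\<lambda>z::'a. kern \<delta> z)"
proof -
  show int: "integrable lborel (\<lambda>z::'a. kern \<delta> z)"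
  proof (rule integrable_lborel_bound[OF integrable_indicator_compact[of "cball 0 \<delta>" "\<delta> ^ 4 / \<delta> ^ (DIM('a) + 4)"]])
    show "AE z in lborel. norm (kern \<delta> (z::'a)) \<le> \<delta> ^ 4 / \<delta> ^ (DIM('a) + 4) * indicator (cball 0 \<delta>) z"
    proof (rule AE_I2)
      fix z :: 'a
      show "norm (kern \<delta> z) \<le> \<delta> ^ 4 / \<delta> ^ (DIM('a) + 4) * indicator (cball 0 \<delta>) z"
        using assms kern_le[OF assms, of z] kern_nonneg[of \<delta> z] kern_eq_0(1)[of \<delta> z] by (cases "norm z \<le> \<delta>") auto
    qed
  qed auto
  have "9 / 16 * measure lborel (ball (0::'a::euclidean_space) 1) / 2 ^ DIM('a) =
      9 / 16 * \<delta> ^ 4 / \<delta> ^ (DIM('a) + 4) * ((\<delta> / 2) ^ DIM('a) * measure lborel (ball (0::'a) 1))"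
    using assms by (simp add: power_add power_divide field_simps)
  also have "\<dots> = (\<integral>z. 9 / 16 * \<delta> ^ 4 / \<delta> ^ (DIM('a) + 4) * indicator (cball (0::'a) (\<delta>/2)) z \<partial>lborel)"
    using assms content_ball_conv_unit_ball[of "\<delta> / 2" "0::'a"] by (simp add: content_cball_conv_ball)
  also have "\<dots> \<le> (\<integral>z. kern \<delta> (z::'a) \<partial>lborel)"
  proof (rule integral_mono[OF integrable_indicator_compact int])
    fix z :: 'a
    show "9 / 16 * \<delta> ^ 4 / \<delta> ^ (DIM('a) + 4) * indicator (cball 0 (\<delta>/2)) z \<le> kern \<delta> z"
    proof (cases "norm z \<le> \<delta> / 2")
      case True
      have "(norm z)\<^sup>2 \<le> (\<delta> / 2)\<^sup>2" using True by (intro power_mono) auto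
      then have "3 / 4 * \<delta>\<^sup>2 \<le> bump \<delta> z" by (simp add: bump_def power_divide le_max_iff_disj)
      then have "(3 / 4 * \<delta>\<^sup>2)\<^sup>2 \<le> (bump \<delta> z)\<^sup>2" using assms by (intro power_mono) auto
      moreover have "(3 / 4 * \<delta>\<^sup>2)\<^sup>2 = 9 / 16 * \<delta> ^ 4" by (simp add: power_mult_distrib power2_eq_square power_divide eval_nat_numeral)
      ultimately have "9 / 16 * \<delta> ^ 4 / \<delta> ^ (DIM('a) + 4) \<le> kern \<delta> z"
        unfolding kern_def using assms by (intro divide_right_mono) auto
      then show ?thesis using True by simp
    qed (use assms kern_nonneg[of \<delta> z] in auto)
  qed simp
  finally show "9 / 16 * measure lborel (ball (0::'a::euclidean_space) 1) / 2 ^ DIM('a) \<le> (\<integral>z. kern \<delta> (z::'a) \<partial>lborel)" .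
qed

text \<open>A function \<open>V\<close> with \<open>\<Delta> V \<ge> -1\<close> in the sense of distributions.\<close>

locale almost_subharmonic =
  fixes V :: "'a::euclidean_space \<Rightarrow> real" and R :: real
  assumes meas_V: "V \<in> borel_measurable borel"
    and int_V: "integrable lborel (\<lambda>x. indicator (ball 0 (R + 2)) x * V x)"
    and sub_V: "\<And>\<psi> p q. C1c_test (ball 0 (R + 2)) \<psi> p \<Longrightarrow> (\<And>x. 0 \<le> \<psi> x) \<Longrightarrow>
      (\<And>b. b \<in> Basis \<Longrightarrow> C1c_test (ball 0 (R + 2)) (\<lambda>x. p x \<bullet> b) (q b)) \<Longrightarrow>
      - (\<integral>x. \<psi> x \<partial>lborel) \<le> (\<integral>x. V x * (\<Sum>b\<in>Basis. q b x \<bullet> b) \<partial>lborel)"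
begin

lemmas [measurable] = meas_V

text \<open>The majorant of all kernel averages: kernels of radius at most 1 centred in the ball of
  radius \<open>R\<close> stay inside the ball of radius \<open>R + 2\<close>, so \<open>V0\<close>
  equals \<open>\<bar>V x\<bar>\<close> wherever they are nonzero.\<close>

definition V0 :: "'a \<Rightarrow> real" where "V0 x = \<bar>indicator (ball 0 (R + 2)) x * V x\<bar>"

lemma int_V0: "integrable lborel V0" unfolding V0_def using int_V by (rule integrable_abs)

lemma V0_eq: "norm y < R \<Longrightarrow> norm (x - y) \<le> 1 \<Longrightarrow> V0 x = \<bar>V x\<bar>"
  using norm_triangle_sub[of x y] by (auto simp: V0_def indicator_def)

lemma integrable_V_kern:
  assumes "norm y < R" "0 < r" "r \<le> 1"
  shows "integrable lborel (\<lambda>x. V x * kern r (x - y))"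
proof (rule integrable_lborel_bound[OF integrable_mult_right[OF int_V0, of "r ^ 4 / r ^ (DIM('a) + 4)"]])
  show "AE x in lborel. norm (V x * kern r (x - y)) \<le> r ^ 4 / r ^ (DIM('a) + 4) * V0 x"
  proof (rule AE_I2)
    fix x
    show "norm (V x * kern r (x - y)) \<le> r ^ 4 / r ^ (DIM('a) + 4) * V0 x"
    proof (cases "norm (x - y) \<le> 1")
      case True
      have "\<bar>V x\<bar> * kern r (x - y) \<le> \<bar>V x\<bar> * (r ^ 4 / r ^ (DIM('a) + 4))"
        using kern_le[OF assms(2)] by (intro mult_left_mono) auto
      then show ?thesis using V0_eq[OF assms(1) True] kern_nonneg[of r "x - y"] assms
        by (simp add: abs_mult mult.commute)
    next
      case False
      then have "kern r (x - y) = 0" using assms by (intro kern_eq_0) auto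
      moreover have "0 \<le> V0 x" by (simp add: V0_def)
      ultimately show ?thesis using assms by simp
    qed
  qed
qed simp

text \<open>The difference of the kernels at scales 1 and \<open>\<delta>\<close> is the integral of
  \<open>dkern r\<close> over \<open>r\<close> between \<open>\<delta>\<close> and 1. Paired with
  \<open>V\<close>, each slice is at least \<open>- r * v\<close>, so passing from scale 1 to
  \<open>\<delta>\<close> raises the average by at most \<open>v\<close>.\<close>

lemma kern_mean_le:
  assumes y: "norm y < R" and \<delta>: "0 < \<delta>" "\<delta> \<le> 1"
  shows "(\<integral>x. V x * kern \<delta> (x - y) \<partial>lborel) \<le> (\<integral>x. V0 x \<partial>lborel) + measure lborel (ball (0::'a) 1)"
proof -
  define v where "v = measure lborel (ball (0::'a) 1)"
  have v: "0 \<le> v" by (simp add: v_def)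
  define C where "C = (DIM('a) + 8) / \<delta> ^ (DIM('a) + 5)"
  have C: "C > 0" using \<delta> by (simp add: C_def)
  define F where "F x r = V x * (dkern r (x - y) * indicator {\<delta>..1} r)" for x r
  have intF: "integrable (lborel \<Otimes>\<^sub>M lborel) (case_prod F)"
  proof (rule integrable_lborel_pair_bound)
    show "integrable lborel (\<lambda>r::real. C * indicator {\<delta>..1} r)" by (rule integrable_indicator_compact) simp
    show "\<bar>case_prod F (x, r)\<bar> \<le> V0 x * (C * indicator {\<delta>..1} r)" for x r
    proof (cases "norm (x - y) \<le> 1 \<and> r \<in> {\<delta>..1}")
      case True
      then have "\<bar>V x\<bar> * \<bar>dkern r (x - y)\<bar> \<le> \<bar>V x\<bar> * C"
        unfolding C_def using abs_dkern_le[OF \<delta>(1), of r "x - y"] by (intro mult_left_mono) auto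
      then show ?thesis using True V0_eq[OF y, of x] by (simp add: F_def abs_mult)
    next
      case False
      then have "F x r = 0" using \<delta> kern_eq_0(2)[of r "x - y"] by (auto simp: F_def indicator_def)
      then show ?thesis using C by (simp add: V0_def)
    qed
    show "case_prod F \<in> borel_measurable (lborel \<Otimes>\<^sub>M lborel)" unfolding F_def[abs_def] by measurable
  qed (rule int_V0)
  have Fx: "(\<integral>r. F x r \<partial>lborel) = V x * kern 1 (x - y) - V x * kern \<delta> (x - y)" for x
  proof -
    have "(\<integral>r. dkern r (x - y) * indicator {\<delta>..1} r \<partial>lborel) = kern 1 (x - y) - kern \<delta> (x - y)"
    proof (rule integral_FTC_Icc_real[OF \<delta>(2)])
      show "isCont (\<lambda>r. dkern r (x - y)) r" if "\<delta> \<le> r" for r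
        using continuous_dkern[of "x - y"] that \<delta> by (subst (asm) continuous_on_eq_continuous_at) auto
    qed (use DERIV_kern[where z="x - y"] \<delta> in auto)
    then show ?thesis by (simp add: F_def right_diff_distrib)
  qed
  have Fr: "(\<integral>x. F x r \<partial>lborel) \<ge> - v * indicator {\<delta>..1} r" for r
  proof (cases "r \<in> {\<delta>..1}")
    case True
    then have r: "0 < r" "r \<le> 1" using \<delta> by auto
    have "cball y r \<subseteq> ball 0 (R + 2)"
    proof
      fix x assume "x \<in> cball y r"
      then have "norm (x - y) \<le> 1" using r by (auto simp: dist_norm norm_minus_commute)
      then show "x \<in> ball 0 (R + 2)" using norm_triangle_sub[of x y] y by simp
    qed
    from dkern_laplacian[OF r(1) this] obtain \<psi> p q where *: "C1c_test (ball 0 (R + 2)) \<psi> p" "\<And>x. 0 \<le> \<psi> x"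
      "\<And>b. b \<in> Basis \<Longrightarrow> C1c_test (ball 0 (R + 2)) (\<lambda>x. p x \<bullet> b) (q b)"
      "\<And>x. (\<Sum>b\<in>Basis. q b x \<bullet> b) = dkern r (x - y)" "(\<integral>x. \<psi> x \<partial>lborel) \<le> r * v" unfolding v_def by blast
    have "- (\<integral>x. \<psi> x \<partial>lborel) \<le> (\<integral>x. V x * dkern r (x - y) \<partial>lborel)"
      using sub_V[OF *(1-3)] by (simp add: *(4))
    moreover have "r * v \<le> v" using r v by (simp add: mult_left_le_one_le)
    ultimately show ?thesis using True *(5) by (simp add: F_def)
  qed (simp add: F_def)
  have "- v \<le> (\<integral>r. - v * indicator {\<delta>..1} r \<partial>lborel)" using \<delta> v by (simp add: algebra_simps)
  also have "\<dots> \<le> (\<integral>r. (\<integral>x. F x r \<partial>lborel) \<partial>lborel)"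
  proof (rule integral_mono)
    show "integrable lborel (\<lambda>r. - v * indicator {\<delta>..1} r)" by (rule integrable_indicator_compact) simp
    show "integrable lborel (\<lambda>r. \<integral>x. F x r \<partial>lborel)" by (rule lborel_pair.integrable_snd[OF intF])
  qed (use Fr in simp)
  also have "\<dots> = (\<integral>x. (\<integral>r. F x r \<partial>lborel) \<partial>lborel)" by (rule lborel_pair.Fubini_integral[OF intF])
  also have "\<dots> = (\<integral>x. V x * kern 1 (x - y) \<partial>lborel) - (\<integral>x. V x * kern \<delta> (x - y) \<partial>lborel)"
    unfolding Fx using integrable_V_kern[OF y] \<delta> by (intro Bochner_Integration.integral_diff) auto
  finally have 1: "(\<integral>x. V x * kern \<delta> (x - y) \<partial>lborel) \<le> (\<integral>x. V x * kern 1 (x - y) \<partial>lborel) + v" by simp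
  \<comment> \<open>The kernel of scale 1 is bounded by 1, so its averages are bounded by the L1
    norm, uniformly in \<open>y\<close>.\<close>
  have "(\<integral>x. V x * kern 1 (x - y) \<partial>lborel) \<le> (\<integral>x. V0 x \<partial>lborel)"
  proof (rule integral_mono[OF integrable_V_kern[OF y] int_V0])
    fix x
    show "V x * kern 1 (x - y) \<le> V0 x"
    proof (cases "norm (x - y) \<le> 1")
      case True
      have "V x * kern 1 (x - y) \<le> \<bar>V x\<bar> * kern 1 (x - y)" using kern_nonneg[of 1 "x - y"] by (intro mult_right_mono) auto
      also have "\<dots> \<le> \<bar>V x\<bar> * 1" using kern_le[of 1 "x - y"] by (intro mult_left_mono) auto
      finally show ?thesis using V0_eq[OF y True] by simp
    next
      case False
      then have "kern 1 (x - y) = 0" by (intro kern_eq_0) auto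
      then show ?thesis by (simp add: V0_def)
    qed
  qed auto
  with 1 show ?thesis by (simp add: v_def)
qed

text \<open>Averaging the kernel means against \<open>\<phi>\<close> takes the place of Lebesgue
  differentiation: after Fubini the kernel falls on \<open>\<phi>\<close>, whose Lipschitz constant
  \<open>L\<close> gives an error \<open>L * \<delta>\<close> times the L1 norm, and
  \<open>\<delta>\<close> tends to 0. \<open>J\<close> is the lower bound for the kernel mass, by
  which the bound in \<open>M\<close> is normalised.\<close>

lemma test_integral_le:
  fixes \<phi> :: "'a \<Rightarrow> real"
  defines "J \<equiv> 9 / 16 * measure lborel (ball (0::'a) 1) / 2 ^ DIM('a)"
  defines "M \<equiv> ((\<integral>x. V0 x \<partial>lborel) + measure lborel (ball (0::'a) 1)) / J"
  assumes \<phi>: "C1c_test (ball 0 R) \<phi> g" and \<phi>0: "\<And>x. 0 \<le> \<phi> x"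
  shows "(\<integral>x. V x * \<phi> x \<partial>lborel) \<le> M * (\<integral>x. \<phi> x \<partial>lborel)" and "integrable lborel (\<lambda>x. V x * \<phi> x)"
proof -
  note C1 = C1c_test_C1_grad[OF \<phi>]
  have [measurable]: "\<phi> \<in> borel_measurable borel" using C1_gradD[OF C1] by auto
  obtain K where K: "compact K" "K \<subseteq> ball 0 R" "\<And>x. x \<notin> K \<Longrightarrow> \<phi> x = 0"
    using C1c_test_supportE[OF \<phi>] by metis
  have i\<phi>: "integrable lborel \<phi>" by (rule integrable_continuous_compact_support[OF C1_gradD(3)[OF C1] K(1,3)])
  obtain C where C: "C > 0" "\<And>x. norm (\<phi> x) \<le> C * indicator K x"
    using continuous_compact_support_bounded[OF C1_gradD(3)[OF C1] K(1,3)] by blast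
  obtain L where L: "L > 0" "\<And>x y. \<bar>\<phi> x - \<phi> y\<bar> \<le> L * norm (x - y)" using C1c_test_lipschitz[OF \<phi>] by blast
  have out: "\<phi> x = 0" if "\<not> norm x < R" for x using K(2,3) that by (metis mem_ball_0 subsetD)
  show int1: "integrable lborel (\<lambda>x. V x * \<phi> x)"
  proof (rule integrable_lborel_bound[OF integrable_mult_right[OF int_V0, of C]])
    show "AE x in lborel. norm (V x * \<phi> x) \<le> C * V0 x"
    proof (rule AE_I2)
      fix x
      show "norm (V x * \<phi> x) \<le> C * V0 x"
      proof (cases "norm x < R")
        case True
        have "\<bar>\<phi> x\<bar> \<le> C" using C(1) C(2)[of x] by (cases "x \<in> K") auto
        then have "\<bar>V x\<bar> * \<bar>\<phi> x\<bar> \<le> \<bar>V x\<bar> * C" by (intro mult_left_mono) auto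
        then show ?thesis using V0_eq[OF True, of x] by (simp add: abs_mult mult.commute)
      qed (use out C in \<open>auto simp: V0_def\<close>)
    qed
  qed simp
  have v: "measure lborel (ball (0::'a) 1) > 0" by simp
  have J: "J > 0" unfolding J_def using v by simp
  have M0: "0 \<le> M * J" using J v by (auto simp: M_def V0_def intro!: add_nonneg_nonneg)
  have step: "(\<integral>x. V x * \<phi> x \<partial>lborel) \<le> M * (\<integral>x. \<phi> x \<partial>lborel) + L * \<delta> * (\<integral>x. V0 x \<partial>lborel)"
    if \<delta>: "0 < \<delta>" "\<delta> \<le> 1" for \<delta>
  proof -
    define Jd where "Jd = (\<integral>z. kern \<delta> (z::'a) \<partial>lborel)"
    have Jd: "J \<le> Jd" using kern_mass_ge(1)[OF \<delta>(1), where 'a='a] by (simp add: J_def Jd_def)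
    define F where "F x y = V x * (\<phi> y * kern \<delta> (x - y))" for x y
    define c where "c = \<delta> ^ 4 / \<delta> ^ (DIM('a) + 4)"
    have c: "c > 0" using \<delta> by (simp add: c_def)
    have intF: "integrable (lborel \<Otimes>\<^sub>M lborel) (case_prod F)"
    proof (rule integrable_lborel_pair_bound[OF _ int_V0 integrable_indicator_compact[OF K(1), of "C * c"]])
      show "\<bar>case_prod F (x, y)\<bar> \<le> V0 x * (C * c * indicator K y)" for x y
      proof (cases "y \<in> K \<and> norm (x - y) \<le> 1")
        case True
        then have "norm y < R" using K(2) by auto
        then have V0: "V0 x = \<bar>V x\<bar>" using V0_eq True by blast
        have "\<bar>\<phi> y\<bar> * kern \<delta> (x - y) \<le> C * c"
          using C(2)[of y] C(1) True kern_le[OF \<delta>(1), of "x - y"] kern_nonneg[of \<delta> "x - y"] \<delta> by (intro mult_mono) (auto simp: c_def)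
        then have "\<bar>V x\<bar> * (\<bar>\<phi> y\<bar> * kern \<delta> (x - y)) \<le> \<bar>V x\<bar> * (C * c)" by (intro mult_left_mono) auto
        then show ?thesis using True V0 kern_nonneg[of \<delta> "x - y"] \<delta> by (simp add: F_def abs_mult)
      next
        case False
        then have "F x y = 0" using \<delta> K(3) kern_eq_0(1)[of \<delta> "x - y"] by (auto simp: F_def)
        then show ?thesis using C c by (simp add: V0_def)
      qed
      show "case_prod F \<in> borel_measurable (lborel \<Otimes>\<^sub>M lborel)" unfolding F_def[abs_def] by measurable
    qed
    have Fy: "(\<integral>x. F x y \<partial>lborel) \<le> (M * J) * \<phi> y" for y
    proof (cases "norm y < R")
      case True
      have "(\<integral>x. F x y \<partial>lborel) = \<phi> y * (\<integral>x. V x * kern \<delta> (x - y) \<partial>lborel)"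
        unfolding F_def by (subst integral_mult_right_zero[symmetric]) (simp add: mult_ac)
      also have "\<dots> \<le> \<phi> y * (M * J)" using kern_mean_le[OF True \<delta>] \<phi>0 J by (intro mult_left_mono) (auto simp: M_def)
      finally show ?thesis by (simp add: mult.commute)
    qed (use out in \<open>simp add: F_def\<close>)
    have kernx: "(\<integral>y. kern \<delta> (x - y) \<partial>lborel) = Jd" "integrable lborel (\<lambda>y. kern \<delta> (x - y))" for x :: 'a
    proof -
      have eq: "kern \<delta> (x - y) = kern \<delta> (y - x)" for y by (simp add: kern_def bump_def norm_minus_commute)
      show "(\<integral>y. kern \<delta> (x - y) \<partial>lborel) = Jd" unfolding eq Jd_def by (rule integral_translate) simp
      have "integrable (distr lborel borel ((+) (- x))) (kern \<delta>)"
        unfolding lborel_distr_plus by (rule kern_mass_ge(2)[OF \<delta>(1)])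
      then show "integrable lborel (\<lambda>y. kern \<delta> (x - y))" unfolding eq by (simp add: integrable_distr_eq)
    qed
    have ipk: "integrable lborel (\<lambda>y. \<phi> y * kern \<delta> (x - y))" for x
    proof (rule integrable_lborel_bound[OF integrable_mult_right[OF kernx(2), of C]])
      have "\<bar>\<phi> y\<bar> \<le> C" for y using C(1) C(2)[of y] by (cases "y \<in> K") auto
      then show "AE y in lborel. norm (\<phi> y * kern \<delta> (x - y)) \<le> C * kern \<delta> (x - y)"
        using kern_nonneg[where 'a='a] \<delta> by (intro AE_I2) (auto simp: abs_mult intro!: mult_right_mono)
    qed simp
    \<comment> \<open>The kernel sees only points within \<open>\<delta>\<close> of
      \<open>x\<close>, so replacing \<open>\<phi> y\<close> by \<open>\<phi> x\<close> costs at
      most \<open>L * \<delta>\<close> times the mass.\<close>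
    have Fx: "Jd * (V x * \<phi> x) - Jd * (L * \<delta> * V0 x) \<le> (\<integral>y. F x y \<partial>lborel)" for x
    proof -
      have "\<bar>(\<integral>y. \<phi> y * kern \<delta> (x - y) \<partial>lborel) - Jd * \<phi> x\<bar> = \<bar>\<integral>y. (\<phi> y - \<phi> x) * kern \<delta> (x - y) \<partial>lborel\<bar>"
        using ipk kernx by (simp add: left_diff_distrib mult.commute)
      also have "\<dots> \<le> (\<integral>y. \<bar>(\<phi> y - \<phi> x) * kern \<delta> (x - y)\<bar> \<partial>lborel)" by (rule integral_abs_bound)
      also have "\<dots> \<le> (\<integral>y. (L * \<delta>) * kern \<delta> (x - y) \<partial>lborel)"
      proof (rule integral_mono_AE)
        show "integrable lborel (\<lambda>y. \<bar>(\<phi> y - \<phi> x) * kern \<delta> (x - y)\<bar>)"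
          using ipk kernx(2) by (intro integrable_abs) (simp add: left_diff_distrib)
        show "AE y in lborel. \<bar>(\<phi> y - \<phi> x) * kern \<delta> (x - y)\<bar> \<le> L * \<delta> * kern \<delta> (x - y)"
        proof (rule AE_I2)
          fix y
          show "\<bar>(\<phi> y - \<phi> x) * kern \<delta> (x - y)\<bar> \<le> L * \<delta> * kern \<delta> (x - y)"
          proof (cases "norm (x - y) \<le> \<delta>")
            case True
            have "\<bar>\<phi> y - \<phi> x\<bar> \<le> L * norm (y - x)" by (rule L(2))
            also have "\<dots> \<le> L * \<delta>" using True L(1) by (intro mult_left_mono) (auto simp: norm_minus_commute)
            finally show ?thesis using kern_nonneg[of \<delta> "x - y"] \<delta> by (auto simp: abs_mult intro!: mult_right_mono)
          next
            case False
            then have "kern \<delta> (x - y) = 0" using \<delta> by (intro kern_eq_0) auto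
            then show ?thesis by simp
          qed
        qed
      qed (use kernx(2) in auto)
      also have "\<dots> = Jd * (L * \<delta>)" using kernx by simp
      finally have E: "\<bar>(\<integral>y. \<phi> y * kern \<delta> (x - y) \<partial>lborel) - Jd * \<phi> x\<bar> \<le> Jd * (L * \<delta>)" .
      have eq: "(\<integral>y. F x y \<partial>lborel) = V x * (\<integral>y. \<phi> y * kern \<delta> (x - y) \<partial>lborel)"
        unfolding F_def by simp
      show ?thesis
      proof (cases "norm x < R + 2")
        case True
        then have V0: "V0 x = \<bar>V x\<bar>" by (simp add: V0_def)
        have "\<bar>V x * ((\<integral>y. \<phi> y * kern \<delta> (x - y) \<partial>lborel) - Jd * \<phi> x)\<bar> \<le> \<bar>V x\<bar> * (Jd * (L * \<delta>))"
          unfolding abs_mult using E by (intro mult_left_mono) auto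
        then show ?thesis unfolding eq V0 by (simp add: algebra_simps abs_le_iff)
      next
        \<comment> \<open>Here \<open>V0\<close> gives no control over \<open>V x\<close>, but every
          point closer to \<open>x\<close> than \<open>\<delta>\<close> lies outside the support of
          \<open>\<phi>\<close>, so the integral of \<open>F x\<close> is zero.\<close>
        case False
        then have "\<phi> x = 0" using out by auto
        have z: "\<phi> y * kern \<delta> (x - y) = 0" for y
        proof (cases "norm y < R")
          case True
          then have "norm (x - y) \<ge> \<delta>" using False norm_triangle_sub[of x y] \<delta> by linarith
          then show ?thesis using \<delta> by (simp add: kern_eq_0)
        qed (use out in simp)
        have "(\<integral>y. F x y \<partial>lborel) = 0" by (simp add: F_def[of x] z del: mult_eq_0_iff)
        moreover have "0 \<le> Jd * (L * \<delta> * V0 x)" using Jd J L \<delta> by (simp add: V0_def)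
        ultimately show ?thesis using \<open>\<phi> x = 0\<close> by simp
      qed
    qed
    have "Jd * (\<integral>x. V x * \<phi> x \<partial>lborel) - Jd * (L * \<delta> * (\<integral>x. V0 x \<partial>lborel)) = (\<integral>x. Jd * (V x * \<phi> x) - Jd * (L * \<delta> * V0 x) \<partial>lborel)"
      using int1 int_V0 by simp
    also have "\<dots> \<le> (\<integral>x. (\<integral>y. F x y \<partial>lborel) \<partial>lborel)"
      using int1 int_V0 lborel_pair.integrable_fst[OF intF] Fx
      by (intro integral_mono) auto
    also have "\<dots> = (\<integral>y. (\<integral>x. F x y \<partial>lborel) \<partial>lborel)" by (rule lborel_pair.Fubini_integral[OF intF, symmetric])
    also have "\<dots> \<le> (\<integral>y. (M * J) * \<phi> y \<partial>lborel)"
      using i\<phi> lborel_pair.integrable_snd[OF intF] Fy by (intro integral_mono) auto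
    also have "\<dots> = (M * (\<integral>x. \<phi> x \<partial>lborel)) * J" by simp
    \<comment> \<open>Only a lower bound for the mass is at hand; as \<open>M\<close> and
      \<open>\<phi>\<close> are nonnegative, \<open>J\<close> may be enlarged to the true mass
      \<open>Jd\<close>, which then cancels.\<close>
    also have "\<dots> \<le> (M * (\<integral>x. \<phi> x \<partial>lborel)) * Jd"
    proof (rule mult_left_mono[OF Jd])
      have "0 \<le> M" using M0 J by (simp add: zero_le_mult_iff)
      then show "0 \<le> M * (\<integral>x. \<phi> x \<partial>lborel)" using \<phi>0 by simp
    qed
    finally have "Jd * ((\<integral>x. V x * \<phi> x \<partial>lborel) - L * \<delta> * (\<integral>x. V0 x \<partial>lborel)) \<le> Jd * (M * (\<integral>x. \<phi> x \<partial>lborel))"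
      by (simp add: algebra_simps)
    then show ?thesis using Jd J by (simp add: mult_le_cancel_left_pos)
  qed
  show "(\<integral>x. V x * \<phi> x \<partial>lborel) \<le> M * (\<integral>x. \<phi> x \<partial>lborel)"
  proof (rule tendsto_lowerbound)
    have "((\<lambda>\<delta>. M * (\<integral>x. \<phi> x \<partial>lborel) + L * \<delta> * (\<integral>x. V0 x \<partial>lborel)) \<longlongrightarrow> M * (\<integral>x. \<phi> x \<partial>lborel) + L * 0 * (\<integral>x. V0 x \<partial>lborel)) (at_right 0)"
      by (intro tendsto_intros)
    then show "((\<lambda>\<delta>. M * (\<integral>x. \<phi> x \<partial>lborel) + L * \<delta> * (\<integral>x. V0 x \<partial>lborel)) \<longlongrightarrow> M * (\<integral>x. \<phi> x \<partial>lborel)) (at_right 0)"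
      by simp
    show "eventually (\<lambda>\<delta>. (\<integral>x. V x * \<phi> x \<partial>lborel) \<le> M * (\<integral>x. \<phi> x \<partial>lborel) + L * \<delta> * (\<integral>x. V0 x \<partial>lborel)) (at_right 0)"
      unfolding eventually_at_right_field by (intro exI[of _ 1]) (auto intro!: step)
  qed simp
qed

lemma locally_bounded: "\<exists>M. AE x in lborel. x \<in> ball 0 R \<longrightarrow> V x \<le> M"
proof -
  define M where "M = ((\<integral>x. V0 x \<partial>lborel) + measure lborel (ball (0::'a) 1)) / (9 / 16 * measure lborel (ball (0::'a) 1) / 2 ^ DIM('a))"
  have "AE x in lborel. x \<in> ball 0 R \<longrightarrow> 0 \<le> M - V x"
  proof (rule AE_nonneg_of_tests)
    fix K :: "'a set" assume K: "compact K" "K \<subseteq> ball 0 R"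
    have [measurable]: "K \<in> sets borel" using K by (simp add: borel_compact)
    have sub: "K \<subseteq> ball 0 (R + 2)" using K(2) by auto
    have "integrable lborel (\<lambda>x. indicator K x * V x)"
      by (rule Bochner_Integration.integrable_bound[OF int_V])
         (use sub in \<open>auto simp: indicator_def subset_iff intro!: AE_I2\<close>)
    then show "set_integrable lborel K (\<lambda>x. M - V x)"
      unfolding set_integrable_def using integrable_indicator_compact[OF K(1), of M] by (simp add: right_diff_distrib mult.commute)
  next
    fix \<phi> g assume \<phi>: "C1c_test (ball 0 R) \<phi> g" "\<And>x::'a. 0 \<le> \<phi> x"
    note C1 = C1c_test_C1_grad[OF \<phi>(1)]
    obtain K where K: "compact K" "\<And>x. x \<notin> K \<Longrightarrow> \<phi> x = 0" using C1c_test_supportE[OF \<phi>(1)] by metis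
    have "integrable lborel \<phi>" by (rule integrable_continuous_compact_support[OF C1_gradD(3)[OF C1] K])
    then show "0 \<le> (\<integral>x. (M - V x) * \<phi> x \<partial>lborel)"
      using test_integral_le[OF \<phi>] by (simp add: left_diff_distrib M_def)
  qed auto
  then show ?thesis by (intro exI[of _ M]) auto
qed

end

section \<open>Local boundedness of weak solutions\<close>

lemma open_half_space: "open (half_space e)"
  unfolding half_space_def by (intro open_Collect_less continuous_intros)

lemma powr_minus_le_1: "1 \<le> x \<Longrightarrow> 0 \<le> a \<Longrightarrow> x powr (- a) \<le> (1::real)"
  by (simp add: powr_minus inverse_le_1_iff ge_one_powr_ge_zero)

lemma power2_norm_diff_le: "(norm (a - b))\<^sup>2 \<le> 2 * (norm a)\<^sup>2 + 2 * (norm b)\<^sup>2"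
proof -
  have "(norm (a - b))\<^sup>2 \<le> (norm a + norm b)\<^sup>2" by (intro power_mono norm_triangle_ineq4) simp
  moreover have "0 \<le> (norm a - norm b)\<^sup>2" by simp
  ultimately show ?thesis unfolding power2_sum power2_diff by linarith
qed

text \<open>A cutoff \<open>\<eta>\<close> equal to 1 on the ball puts the truncation into
  \<open>H1_0\<close>, whose definition supplies the approximating test functions; a subsequence
  yields pointwise limits and the majorant. Extension by zero turns integrals over
  \<open>\<Omega>\<close> into integrals over the whole space.\<close>

lemma truncated_solution_exists:
  fixes \<Omega> :: "'a::euclidean_space set"
  assumes \<Omega>: "open \<Omega>" and \<gamma>: "\<gamma> > 0"
    and L1: "L1_loc \<Omega> (\<lambda>x. u x powr (- \<gamma>))" and H1: "H1_loc_grad \<Omega> u G"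
    and eq: "\<And>\<phi> g. C1c_test \<Omega> \<phi> g \<Longrightarrow> (LINT x:\<Omega>|lborel. G x \<bullet> g x) = (LINT x:\<Omega>|lborel. u x powr (- \<gamma>) * \<phi> x)"
    and bdry: "\<And>\<phi>. C1c \<phi> \<Longrightarrow> H1_0 \<Omega> (\<lambda>x. max (u x - 1) 0 * \<phi> x * indicator \<Omega> x)"
  obtains f W D G' \<Gamma> \<phi> g where
    "truncated_solution \<Omega> (ball 0 \<rho>) (\<lambda>x. indicator \<Omega> x * u x) f W D G' \<Gamma> \<phi> g"
proof -
  have [measurable]: "\<Omega> \<in> sets borel" using \<Omega> by simp
  obtain \<eta> \<eta>' where \<eta>: "C1c_test UNIV \<eta> \<eta>'" "\<And>x. 0 \<le> \<eta> x" "\<And>x::'a. x \<in> cball 0 \<rho> \<Longrightarrow> \<eta> x = 1"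
    using C1c_cutoff[OF compact_cball open_UNIV subset_UNIV] by metis
  define W where "W x = max (u x - 1) 0 * \<eta> x * indicator \<Omega> x" for x
  have "H1_0 \<Omega> W" unfolding W_def[abs_def] by (rule bdry) (use \<eta>(1) in \<open>auto simp: C1c_def\<close>)
  then obtain G1 \<phi> g where H0: "L2 \<Omega> W" "L2 \<Omega> G1" "weak_gradient \<Omega> W G1" "\<And>k. C1c_test \<Omega> (\<phi> k) (g k)"
    "(\<lambda>k. LINT x:\<Omega>|lborel. (W x - \<phi> k x)\<^sup>2 + (norm (G1 x - g k x))\<^sup>2) \<longlonglongrightarrow> 0"
    unfolding H1_0_def by blast
  define u0 where "u0 x = indicator \<Omega> x * u x" for x
  define f where "f x = indicator \<Omega> x * u x powr (- \<gamma>)" for x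
  define G0 where "G0 x = indicator \<Omega> x *\<^sub>R G x" for x
  define \<Gamma> where "\<Gamma> x = indicator \<Omega> x *\<^sub>R G1 x" for x
  have W_ind: "indicator \<Omega> x *\<^sub>R W x = W x" for x by (simp add: W_def indicator_def)
  have [measurable]: "u0 \<in> borel_measurable borel" "f \<in> borel_measurable borel" "W \<in> borel_measurable borel"
    "G0 \<in> borel_measurable borel" "\<Gamma> \<in> borel_measurable borel"
    using H1 L1 H0(1,2) unfolding H1_loc_grad_def L2_loc_def L2_def L1_loc_def set_borel_measurable_def
      u0_def[abs_def] f_def[abs_def] G0_def[abs_def] \<Gamma>_def[abs_def] W_ind by auto
  have iW: "integrable lborel (\<lambda>x. (W x)\<^sup>2)"
  proof -
    have *: "(\<lambda>x. indicator \<Omega> x *\<^sub>R (norm (W x))\<^sup>2) = (\<lambda>x. (W x)\<^sup>2)" by (auto simp: W_def indicator_def)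
    show ?thesis using H0(1) unfolding L2_def set_integrable_def * by blast
  qed
  have i\<Gamma>: "integrable lborel (\<lambda>x. (norm (\<Gamma> x))\<^sup>2)"
  proof -
    have *: "(\<lambda>x. indicator \<Omega> x *\<^sub>R (norm (G1 x))\<^sup>2) = (\<lambda>x. (norm (\<Gamma> x))\<^sup>2)" by (auto simp: \<Gamma>_def indicator_def)
    show ?thesis using H0(2) unfolding L2_def set_integrable_def * by blast
  qed
  have m\<phi>[measurable]: "\<phi> k \<in> borel_measurable borel" "g k \<in> borel_measurable borel" for k
    using C1_gradD(4,5)[OF C1c_test_C1_grad[OF H0(4)]] by auto
  define d where "d k x = (norm (W x - \<phi> k x))\<^sup>2 + (norm (\<Gamma> x - g k x))\<^sup>2" for k x
  have d_eq: "indicator \<Omega> x *\<^sub>R ((W x - \<phi> k x)\<^sup>2 + (norm (G1 x - g k x))\<^sup>2) = d k x" for k x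
    using C1c_test_outside[OF H0(4)[of k], of x] by (cases "x \<in> \<Omega>") (auto simp: d_def W_def \<Gamma>_def)
  have int_d: "integrable lborel (d k)" for k
  proof -
    note C1 = C1c_test_C1_grad[OF H0(4)[of k]]
    obtain K where K: "compact K" "\<And>x. x \<notin> K \<Longrightarrow> \<phi> k x = 0" "\<And>x. x \<notin> K \<Longrightarrow> g k x = 0"
      using C1c_test_supportE[OF H0(4)[of k]] by metis
    have "integrable lborel (\<lambda>x. (norm (\<phi> k x))\<^sup>2)" "integrable lborel (\<lambda>x. (norm (g k x))\<^sup>2)"
      by (rule integrable_continuous_compact_support[OF _ K(1)],
          use K C1_gradD[OF C1] in \<open>auto intro!: continuous_intros\<close>)+
    then have w: "integrable lborel (\<lambda>x. (2 * (norm (W x))\<^sup>2 + 2 * (norm (\<phi> k x))\<^sup>2) + (2 * (norm (\<Gamma> x))\<^sup>2 + 2 * (norm (g k x))\<^sup>2))"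
      using iW i\<Gamma> by simp
    show ?thesis
    proof (rule integrable_lborel_bound[OF w])
      have "d k x \<le> (2 * (norm (W x))\<^sup>2 + 2 * (norm (\<phi> k x))\<^sup>2) + (2 * (norm (\<Gamma> x))\<^sup>2 + 2 * (norm (g k x))\<^sup>2)" for x
        unfolding d_def by (intro add_mono power2_norm_diff_le)
      moreover have "norm (d k x) = d k x" for x by (simp add: d_def)
      ultimately show "AE x in lborel. norm (d k x) \<le> (2 * (norm (W x))\<^sup>2 + 2 * (norm (\<phi> k x))\<^sup>2) + (2 * (norm (\<Gamma> x))\<^sup>2 + 2 * (norm (g k x))\<^sup>2)"
        by simp
    qed (simp add: d_def[abs_def])
  qed
  have "(\<lambda>k. \<integral>x. d k x \<partial>lborel) \<longlonglongrightarrow> 0"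
    using H0(5) unfolding set_lebesgue_integral_def d_eq .
  from dominated_subsequence[OF int_d _ this] obtain r S where r: "strict_mono (r :: nat \<Rightarrow> nat)" "integrable lborel S"
    "AE x in lborel. (\<lambda>k. d (r k) x) \<longlonglongrightarrow> 0 \<and> (\<forall>k. d (r k) x \<le> S x)"
    by (auto simp: d_def)
  have [measurable]: "S \<in> borel_measurable borel" using r(2) by auto
  \<comment> \<open>Each approximant is bounded by its limit plus its distance to it, and both
    squared distances are at most the integrable \<open>S\<close>; hence one square integrable
    function dominates values and gradients.\<close>
  define D where "D x = \<bar>W x\<bar> + norm (\<Gamma> x) + sqrt \<bar>S x\<bar>" for x
  have [measurable]: "D \<in> borel_measurable borel" by (simp add: D_def[abs_def])
  have W_nonneg: "0 \<le> W x" for x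
    using \<eta>(2) by (auto simp: W_def)
  have lim: "AE x in lborel. (\<lambda>k. \<phi> (r k) x) \<longlonglongrightarrow> W x \<and> (\<lambda>k. g (r k) x) \<longlonglongrightarrow> \<Gamma> x \<and>
      (\<forall>k. \<bar>\<phi> (r k) x\<bar> \<le> D x \<and> norm (g (r k) x) \<le> D x)"
    using r(3)
  proof eventually_elim
    case (elim x)
    have sq: "norm (W x - \<phi> (r k) x) \<le> sqrt (d (r k) x)" "norm (\<Gamma> x - g (r k) x) \<le> sqrt (d (r k) x)" for k
      by (rule real_le_rsqrt; simp add: d_def)+
    have s0: "(\<lambda>k. sqrt (d (r k) x)) \<longlonglongrightarrow> 0" using tendsto_real_sqrt[of _ 0] elim by fastforce
    have "(\<lambda>k. W x - \<phi> (r k) x) \<longlonglongrightarrow> 0" "(\<lambda>k. \<Gamma> x - g (r k) x) \<longlonglongrightarrow> 0"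
      by (rule Lim_null_comparison[OF always_eventually s0], use sq in blast)+
    from this[THEN tendsto_diff[OF tendsto_const]]
    have "(\<lambda>k. W x - (W x - \<phi> (r k) x)) \<longlonglongrightarrow> W x - 0" "(\<lambda>k. \<Gamma> x - (\<Gamma> x - g (r k) x)) \<longlonglongrightarrow> \<Gamma> x - 0" by blast+
    moreover have "\<bar>\<phi> (r k) x\<bar> \<le> D x \<and> norm (g (r k) x) \<le> D x" for k
    proof -
      have "sqrt (d (r k) x) \<le> sqrt \<bar>S x\<bar>" using elim abs_ge_self[of "S x"] order_trans by (intro real_sqrt_le_mono) blast
      moreover have "\<bar>\<phi> (r k) x\<bar> \<le> \<bar>W x\<bar> + norm (W x - \<phi> (r k) x)" by simp
      moreover have "norm (g (r k) x) \<le> norm (\<Gamma> x) + norm (\<Gamma> x - g (r k) x)"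
        using norm_triangle_sub[of "g (r k) x" "\<Gamma> x"] by (simp add: norm_minus_commute)
      moreover have "0 \<le> \<bar>W x\<bar>" "0 \<le> norm (\<Gamma> x)" by simp_all
      ultimately show ?thesis using sq[of k] unfolding D_def by linarith
    qed
    ultimately show ?case by simp
  qed
  have D_L2: "integrable lborel (\<lambda>x. (D x)\<^sup>2)"
  proof (rule integrable_lborel_bound)
    show "integrable lborel (\<lambda>x. 3 * (W x)\<^sup>2 + 3 * (norm (\<Gamma> x))\<^sup>2 + 3 * \<bar>S x\<bar>)" using iW i\<Gamma> r(2) by simp
    have "(a + b + c)\<^sup>2 \<le> 3 * a\<^sup>2 + 3 * b\<^sup>2 + 3 * c\<^sup>2" for a b c :: real
    proof -
      have "0 \<le> (a - b)\<^sup>2 + (b - c)\<^sup>2 + (a - c)\<^sup>2" by simp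
      then show ?thesis by (simp add: power2_eq_square algebra_simps)
    qed
    from this[of "\<bar>W x\<bar>" "norm (\<Gamma> x)" "sqrt \<bar>S x\<bar>" for x]
    show "AE x in lborel. norm ((D x)\<^sup>2) \<le> 3 * (W x)\<^sup>2 + 3 * (norm (\<Gamma> x))\<^sup>2 + 3 * \<bar>S x\<bar>"
      unfolding D_def by simp
  qed simp
  have indK: "indicator K x * (indicator \<Omega> x * c) = (indicator K x * c :: real)" if "K \<subseteq> \<Omega>" for K x and c :: real
    using that by (auto simp: indicator_def)
  have "truncated_solution \<Omega> (ball 0 \<rho>) u0 f W D G0 \<Gamma> (\<lambda>k. \<phi> (r k)) (\<lambda>k. g (r k))"
  proof
    fix K assume K: "compact K" "K \<subseteq> \<Omega>"
    have *: "indicator K x * (u0 x)\<^sup>2 = indicator K x *\<^sub>R (norm (u x))\<^sup>2" "indicator K x * (norm (G0 x))\<^sup>2 = indicator K x *\<^sub>R (norm (G x))\<^sup>2" for x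
      using K(2) by (auto simp: u0_def G0_def indicator_def)
    show "integrable lborel (\<lambda>x. indicator K x * (u0 x)\<^sup>2)" "integrable lborel (\<lambda>x. indicator K x * (norm (G0 x))\<^sup>2)"
      using H1 K unfolding * H1_loc_grad_def L2_loc_def set_integrable_def by blast+
    show "integrable lborel (\<lambda>x. indicator K x * f x)"
      using L1 K unfolding L1_loc_def set_integrable_def f_def by (auto simp: indK)
  next
    fix x assume "x \<in> \<Omega>" "1 < u0 x"
    then show "f x \<le> 1" using powr_minus_le_1[of "u x" \<gamma>] \<gamma> by (simp add: f_def u0_def)
  next
    fix \<zeta> h assume t: "C1c_test \<Omega> \<zeta> h"
    have "(LINT x:\<Omega>|lborel. u x *\<^sub>R h x) = - (LINT x:\<Omega>|lborel. \<zeta> x *\<^sub>R G x)"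
      using H1 t unfolding H1_loc_grad_def weak_gradient_def by blast
    then show "(\<integral>x. u0 x *\<^sub>R h x \<partial>lborel) = - (\<integral>x. \<zeta> x *\<^sub>R G0 x \<partial>lborel)"
      unfolding set_lebesgue_integral_def u0_def G0_def by (simp add: mult.commute)
    show "(\<integral>x. G0 x \<bullet> h x \<partial>lborel) = (\<integral>x. f x * \<zeta> x \<partial>lborel)"
      using eq[OF t] unfolding set_lebesgue_integral_def f_def G0_def by (simp add: mult.assoc)
    have "(LINT x:\<Omega>|lborel. W x *\<^sub>R h x) = - (LINT x:\<Omega>|lborel. \<zeta> x *\<^sub>R G1 x)"
      using H0(3) t unfolding weak_gradient_def by blast
    moreover have *: "indicator \<Omega> x *\<^sub>R (W x *\<^sub>R h x) = W x *\<^sub>R h x" for x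
      by (simp add: W_def indicator_def)
    ultimately show "(\<integral>x. W x *\<^sub>R h x \<partial>lborel) = - (\<integral>x. \<zeta> x *\<^sub>R \<Gamma> x \<partial>lborel)"
      unfolding set_lebesgue_integral_def * \<Gamma>_def by (simp add: mult.commute)
  next
    show "W x = max (u0 x - 1) 0" if "x \<in> \<Omega> \<inter> ball 0 \<rho>" for x
      using that \<eta>(3)[of x] by (simp add: W_def u0_def)
  qed (use \<Omega> H0(4) D_L2 lim W_nonneg in auto)
  then show ?thesis using that unfolding u0_def by blast
qed

theorem theorem2p1:
  fixes e :: "'a::euclidean_space" and \<gamma> :: real and u :: "'a \<Rightarrow> real"
  assumes "e \<in> Basis" and "\<gamma> > 0"
    and "H1_loc (half_space e) u"
    and "weak_solution e \<gamma> u"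
  shows "\<forall>R>0. \<exists>C. AE x in lborel. x \<in> ball 0 R \<inter> half_space e \<longrightarrow> \<bar>u x\<bar> \<le> C"
proof (intro allI impI)
  fix R :: real assume "R > 0"
  let ?\<Omega> = "half_space e"
  have pos: "\<And>x. x \<in> ?\<Omega> \<Longrightarrow> 0 < u x" and L1: "L1_loc ?\<Omega> (\<lambda>x. u x powr (- \<gamma>))"
    and bdry: "\<And>\<phi>. C1c \<phi> \<Longrightarrow> H1_0 ?\<Omega> (\<lambda>x. max (u x - 1) 0 * \<phi> x * indicator ?\<Omega> x)"
    using assms(4) unfolding weak_solution_def by auto
  obtain G where G: "H1_loc_grad ?\<Omega> u G" "\<And>\<phi> g. C1c_test ?\<Omega> \<phi> g \<Longrightarrow>
      (LINT x:?\<Omega>|lborel. G x \<bullet> g x) = (LINT x:?\<Omega>|lborel. u x powr (- \<gamma>) * \<phi> x)"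
    using assms(4) unfolding weak_solution_def by blast
  \<comment> \<open>The radius \<open>R + 2\<close> supplies the margin that
    \<open>almost_subharmonic\<close> requires for a bound on the ball of radius
    \<open>R\<close>.\<close>
  obtain f W D G' \<Gamma> \<phi> g where
    "truncated_solution ?\<Omega> (ball 0 (R + 2)) (\<lambda>x. indicator ?\<Omega> x * u x) f W D G' \<Gamma> \<phi> g"
    using truncated_solution_exists[OF open_half_space assms(2) L1 G bdry] by blast
  then interpret truncated_solution ?\<Omega> "ball 0 (R + 2)" "\<lambda>x. indicator ?\<Omega> x * u x" f W D G' \<Gamma> \<phi> g .
  interpret almost_subharmonic "\<lambda>x. \<Lambda> (W x)" R
  proof
    show "integrable lborel (\<lambda>x. indicator (ball 0 (R + 2)) x * \<Lambda> (W x))"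
      by (rule integrable_\<Lambda>_W[OF ball_subset_cball compact_cball])
  qed (rule measurable_\<Lambda>_W, rule laplacian_ge)
  obtain M where "AE x in lborel. x \<in> ball 0 R \<longrightarrow> \<Lambda> (W x) \<le> M" using locally_bounded by blast
  \<comment> \<open>The 4 is the truncation level 1 plus the 3 lost in
    \<open>\<Lambda>_ge\<close>.\<close>
  then have "AE x in lborel. x \<in> ball 0 R \<inter> ?\<Omega> \<longrightarrow> \<bar>u x\<bar> \<le> M + 4"
  proof eventually_elim
    case (elim x)
    show ?case
    proof
      assume x: "x \<in> ball 0 R \<inter> ?\<Omega>"
      then have "W x = max (u x - 1) 0" using W_eq[of x] by auto
      then show "\<bar>u x\<bar> \<le> M + 4" using \<Lambda>_ge[OF W_nonneg[of x]] elim x pos[of x] by auto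
    qed
  qed
  then show "\<exists>C. AE x in lborel. x \<in> ball 0 R \<inter> ?\<Omega> \<longrightarrow> \<bar>u x\<bar> \<le> C" by blast
qed

end
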